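(* Let $\{(R_n,B_n)\}_{n=1}^\infty$ be a sequence of admissible pairs in $\mathbb{R}^d$. Let $$\mu_n=\delta_{R_1^{-1}B_1}*\delta_{(R_2R_1)^{-1}B_2}*\cdots*\delta_{(R_n\cdots R_2R_1)^{-1}B_n},$$ and suppose that $\mu_n$ converges weakly to a Borel probability measure $\mu$ (the infinite convolution). Suppose moreover that $$\lim_{n\to\infty}\|R_1^{-1}R_2^{-1}\cdots R_n^{-1}\|=0.$$ For $n\ge1$ let $$\nu_{>n}=\delta_{R_{n+1}^{-1}B_{n+1}}*\delta_{(R_{n+2}R_{n+1})^{-1}B_{n+2}}*\cdots$$ (the weak limit of $\delta_{R_{n+1}^{-1}B_{n+1}}*\cdots*\delta_{(R_{n+k}\cdots R_{n+1})^{-1}B_{n+k}}$ as $k\to\infty$). If there is a subsequence $\{\nu_{>n_j}\}_{j\ge1}$ which is an equi-positive family, then $\mu$ is a spectral measure with a spectrum contained in $\mathbb{Z}^d$.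
   Context: A Borel probability measure $\mu$ on $\mathbb{R}^d$ is a spectral measure if there is a countable set $\Lambda\subseteq\mathbb{R}^d$ (a spectrum) such that $\{e^{2\pi i\lambda\cdot x}:\lambda\in\Lambda\}$ is an orthonormal basis of $L^2(\mu)$. For a finite set $A\subseteq\mathbb{R}^d$, $\delta_A=\frac{1}{\#A}\sum_{a\in A}\delta_a$. A pair $(R,B)$ with $R$ a $d\times d$ expanding integer matrix (all eigenvalues of modulus $>1$) and $B\subseteq\mathbb{Z}^d$ finite is an admissible pair if there is a finite $L\subseteq\mathbb{Z}^d$ with $\#L=\#B$ such that the matrix $\big[\frac{1}{\sqrt{\#B}}e^{-2\pi i(R^{-1}b)\cdot\ell}\big]_{b\in B,\ell\in L}$ is unitary. The Fourier transform is $\widehat{\mu}(\xi)=\int e^{-2\pi i\xi\cdot x}\,d\mu(x)$. A family $\Phi$ of Borel probability measures on $\mathbb{R}^d$ is equi-positive if there exist $\epsilon>0$ and $\gamma>0$ such that for every $x\in[0,1)^d$ and every $\mu\in\Phi$ there is $k_{x,\mu}\in\mathbb{Z}^d$ with $|\widehat{\mu}(x+y+k_{x,\mu})|\ge\epsilon$ for all $|y|<\gamma$, where $k_{x,\mu}=\mathbf{0}$ when $x=\mathbf{0}$. $\|\cdot\|$ is the operator norm. *)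

theory Defs
  imports "HOL-Analysis.Analysis" "HOL-Probability.Probability"
begin

definition int_vec :: "real^'n \<Rightarrow> bool" where
  "int_vec v \<longleftrightarrow> (\<forall>i. v $ i \<in> \<int>)"

definition int_mat :: "real^'n^'n \<Rightarrow> bool" where
  "int_mat R \<longleftrightarrow> (\<forall>i j. R $ i $ j \<in> \<int>)"

definition expanding :: "real^'n^'n \<Rightarrow> bool" where
  "expanding R \<longleftrightarrow>
     (\<forall>z::complex. det (mat z - (\<chi> i j. complex_of_real (R $ i $ j))) = 0 \<longrightarrow> cmod z > 1)"

text \<open>Admissible pair (B is taken nonempty so that delta_B makes sense).\<close>
definition admissible :: "real^'n^'n \<Rightarrow> (real^'n) set \<Rightarrow> bool" where
  "admissible R B \<longleftrightarrow>
     int_mat R \<and> expanding R \<and> finite B \<and> B \<noteq> {} \<and> (\<forall>b\<in>B. int_vec b) \<and>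
     (\<exists>L. finite L \<and> (\<forall>l\<in>L. int_vec l) \<and> card L = card B \<and>
        (let U = (\<lambda>b l. complex_of_real (1 / sqrt (real (card B))) *
                          cis (- 2 * pi * ((matrix_inv R *v b) \<bullet> l)))
         in (\<forall>b\<in>B. \<forall>b'\<in>B. (\<Sum>l\<in>L. U b l * cnj (U b' l)) = (if b = b' then 1 else 0)) \<and>
            (\<forall>l\<in>L. \<forall>l'\<in>L. (\<Sum>b\<in>B. cnj (U b l) * U b l') = (if l = l' then 1 else 0))))"

fun tailprod :: "(nat \<Rightarrow> real^'n^'n) \<Rightarrow> nat \<Rightarrow> nat \<Rightarrow> real^'n^'n" where
  "tailprod R m 0 = mat 1"
| "tailprod R m (Suc k) = R (m + Suc k) ** tailprod R m k"

fun invprod :: "(nat \<Rightarrow> real^'n^'n) \<Rightarrow> nat \<Rightarrow> real^'n^'n" where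
  "invprod R 0 = mat 1"
| "invprod R (Suc n) = invprod R n ** matrix_inv (R (Suc n))"

text \<open>delta_{A_1} * ... * delta_{A_k} (convolution of uniform discrete measures):
  the distribution of a_1 + ... + a_k with a_i independent and uniform on A_i,
  as a measure on the Borel sets.\<close>
definition conv_deltas :: "(nat \<Rightarrow> (real^'n) set) \<Rightarrow> nat \<Rightarrow> (real^'n) measure" where
  "conv_deltas A k =
     distr (measure_pmf (Pi_pmf {1..k} 0 (\<lambda>i. pmf_of_set (A i)))) borel
           (\<lambda>a. \<Sum>i\<in>{1..k}. a i)"

definition mu_n :: "(nat \<Rightarrow> real^'n^'n) \<Rightarrow> (nat \<Rightarrow> (real^'n) set) \<Rightarrow> nat \<Rightarrow> (real^'n) measure" where
  "mu_n R B n = conv_deltas (\<lambda>i. (\<lambda>b. matrix_inv (tailprod R 0 i) *v b) ` B i) n"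

definition nu_tail :: "(nat \<Rightarrow> real^'n^'n) \<Rightarrow> (nat \<Rightarrow> (real^'n) set) \<Rightarrow> nat \<Rightarrow> nat \<Rightarrow> (real^'n) measure" where
  "nu_tail R B n k = conv_deltas (\<lambda>i. (\<lambda>b. matrix_inv (tailprod R n i) *v b) ` B (n + i)) k"

definition borel_prob :: "(real^'n) measure \<Rightarrow> bool" where
  "borel_prob M \<longleftrightarrow> prob_space M \<and> sets M = sets borel"

definition weak_conv :: "(nat \<Rightarrow> (real^'n) measure) \<Rightarrow> (real^'n) measure \<Rightarrow> bool" where
  "weak_conv M N \<longleftrightarrow>
     (\<forall>f :: real^'n \<Rightarrow> real. continuous_on UNIV f \<and> bounded (range f) \<longrightarrow>
        (\<lambda>k. integral\<^sup>L (M k) f) \<longlonglongrightarrow> integral\<^sup>L N f)"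

definition fourier :: "(real^'n) measure \<Rightarrow> real^'n \<Rightarrow> complex" where
  "fourier M \<xi> = (LINT x|M. cis (- 2 * pi * (\<xi> \<bullet> x)))"

definition equi_positive :: "(real^'n) measure set \<Rightarrow> bool" where
  "equi_positive \<Phi> \<longleftrightarrow>
     (\<exists>\<epsilon>>0. \<exists>\<gamma>>0. \<forall>x. (\<forall>i. 0 \<le> x $ i \<and> x $ i < 1) \<longrightarrow> (\<forall>M\<in>\<Phi>.
        \<exists>k. int_vec k \<and> (x = 0 \<longrightarrow> k = 0) \<and>
           (\<forall>y. norm y < \<gamma> \<longrightarrow> cmod (fourier M (x + y + k)) \<ge> \<epsilon>)))"

definition expo :: "real^'n \<Rightarrow> real^'n \<Rightarrow> complex" where
  "expo lam x = cis (2 * pi * (lam \<bullet> x))"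

text \<open>{expo lambda : lambda in Lambda} is an orthonormal basis of L^2(M):
  orthonormal, and the only L^2 function orthogonal to all of them is 0 a.e.\<close>
definition is_spectrum :: "(real^'n) measure \<Rightarrow> (real^'n) set \<Rightarrow> bool" where
  "is_spectrum M \<Lambda> \<longleftrightarrow> countable \<Lambda> \<and>
     (\<forall>lam\<in>\<Lambda>. \<forall>lam'\<in>\<Lambda>. (LINT x|M. expo lam x * cnj (expo lam' x)) = (if lam = lam' then 1 else 0)) \<and>
     (\<forall>f :: real^'n \<Rightarrow> complex. f \<in> borel_measurable M \<and> integrable M (\<lambda>x. (cmod (f x))\<^sup>2) \<and>
        (\<forall>lam\<in>\<Lambda>. (LINT x|M. f x * cnj (expo lam x)) = 0) \<longrightarrow> (AE x in M. f x = 0))"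

definition spectral_measure :: "(real^'n) measure \<Rightarrow> bool" where
  "spectral_measure M \<longleftrightarrow> borel_prob M \<and> (\<exists>\<Lambda>. is_spectrum M \<Lambda>)"

end

(*
  Call a finite set L "tight" for a measure M if sum_{l in L} |M^(xi + l)|^2 = 1 for all xi.
  Evaluating at xi = -l shows that tightness contains the orthogonality of the exponentials.
  Admissibility turns a tight set for mu_n into a larger one for mu_(n+1), and tightness
  for mu_n survives moving points by R_1^T ... R_n^T Z^d.  Along the equi-positive
  subsequence one uses this freedom to move the new points to places where the Fourier
  transform of nu_{>n} is bounded below by epsilon, while the old points, being small after
  rescaling, may stay.  The factorisation mu^(xi) = mu_n^(xi) nu_{>n}^(R_n^-T ... R_1^-T xi)
  then shows that |mu_n^|^2 is dominated on these sets by |mu^|^2 / epsilon^2, so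
  no mass is lost in the limit and the union of the sets satisfies Parseval's identity for
  every exponential.  The exponentials with arbitrary real frequencies have dense span
  in L^2(mu); this gives completeness.
*)
theory Submission
  imports Defs
begin

section \<open>Uniqueness of the Fourier transform\<close>

lemma expo_measurable [measurable]: "expo \<xi> \<in> borel_measurable borel"
  unfolding expo_def[abs_def] cis_conv_exp by measurable

lemma norm_expo [simp]: "cmod (expo \<xi> x) = 1"
  by (simp add: expo_def)

lemma expo_add: "expo (\<xi> + \<eta>) x = expo \<xi> x * expo \<eta> x"
  by (simp add: expo_def cis_mult inner_add_left algebra_simps)

lemma cnj_expo: "cnj (expo \<xi> x) = expo (- \<xi>) x"
  by (simp add: expo_def cis_cnj)

lemma expo_zero [simp]: "expo 0 x = 1"
  by (simp add: expo_def)

lemma integrable_mult_expo: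
  assumes "sets M = sets borel" "integrable M u"
  shows "integrable M (\<lambda>x. u x * expo \<xi> x)"
proof -
  note measurable_cong_sets[OF assms(1) refl, simp]
  have [measurable]: "u \<in> borel_measurable borel"
    using borel_measurable_integrable[OF assms(2)] by simp
  show ?thesis
    by (rule Bochner_Integration.integrable_bound[OF assms(2)]) (auto simp: norm_mult)
qed

text \<open>Euler's formula, the factor \<open>- \<i> / 2\<close> being
  \<open>1 / (2 * \<i>)\<close>. It exhibits the rescaled coordinate sines as trigonometric
  polynomials.\<close>

lemma sin_as_expo:
  assumes "T \<noteq> 0"
  shows "complex_of_real (sin (x $ i / T)) =
    (expo (axis i (1 / (2 * pi * T))) x - expo (- axis i (1 / (2 * pi * T))) x) * (- \<i> / 2)"
proof -
  have "2 * pi * (axis i (1 / (2 * pi * T)) \<bullet> x) = x $ i / T"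
    using assms by (simp add: inner_axis' field_simps)
  then show ?thesis
    by (simp add: expo_def complex_eq_iff)
qed

text \<open>
  For a polynomial \<open>p\<close>, the function \<open>x \<mapsto> p (T sin (x / T))\<close> is a trigonometric polynomial that
  approaches \<open>p\<close> as \<open>T\<close> grows. Hence Weierstrass approximation on boxes yields uniqueness of the
  Fourier transform without any periodisation. Quantifying over all \<open>u\<close> below makes
  the property closed under products of polynomials.
\<close>

lemma integral_polynomial_sin_eq_0:
  fixes M :: "(real^'n) measure" and p :: "real^'n \<Rightarrow> real"
  assumes sets: "sets M = sets borel" and "real_polynomial_function p" and T: "T \<noteq> 0"
    and "integrable M u" "\<And>\<xi>. (LINT x|M. u x * expo \<xi> x) = 0"
  shows "integrable M (\<lambda>x. u x * of_real (p (\<chi> i. T * sin (x $ i / T))))"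
    and "(LINT x|M. u x * of_real (p (\<chi> i. T * sin (x $ i / T))) * expo \<xi> x) = 0"
proof -
  define S :: "real^'n \<Rightarrow> real^'n" where "S x = (\<chi> i. T * sin (x $ i / T))" for x
  have "integrable M (\<lambda>x. u x * of_real (p (S x))) \<and>
      (\<forall>\<xi>. (LINT x|M. u x * of_real (p (S x)) * expo \<xi> x) = 0)"
    using assms(2,4,5)
  proof (induction p arbitrary: u rule: real_polynomial_function.induct)
    case (linear f)
    interpret f: bounded_linear f by fact
    define a where "a i = axis i (1 / (2 * pi * T))" for i :: 'n
    \<comment> \<open>Expanding \<open>S x\<close> in the standard basis writes
      \<open>f (S x)\<close> as a linear combination of coordinate sines, hence of
      characters.\<close>
    have S_eq: "of_real (f (S x)) =
        (\<Sum>i\<in>UNIV. of_real (f (axis i 1)) * (of_real T * ((expo (a i) x - expo (- a i) x) * (- \<i> / 2))))" for x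
    proof -
      have "S x = (\<Sum>i\<in>UNIV. (T * sin (x $ i / T)) *\<^sub>R axis i 1)"
        by (simp add: S_def vec_eq_iff axis_def if_distrib sum.delta cong: if_cong)
      then have "f (S x) = (\<Sum>i\<in>UNIV. (T * sin (x $ i / T)) * f (axis i 1))"
        by (simp add: f.sum f.scaleR)
      then show ?thesis
        by (simp add: sin_as_expo[OF T] a_def mult_ac)
    qed
    define c where "c i = of_real (f (axis i 1)) * (of_real T * (- \<i> / 2))" for i
    \<comment> \<open>Multiplying by a character only shifts frequencies, so each summand is a
      constant times a difference of two products of \<open>u\<close> with a character, and both
      integrate to 0.\<close>
    have *: "u x * of_real (f (S x)) * expo \<xi> x =
       (\<Sum>i\<in>UNIV. c i * (u x * expo (a i + \<xi>) x - u x * expo (- a i + \<xi>) x))" for x \<xi>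
      unfolding S_eq sum_distrib_left sum_distrib_right
      by (intro sum.cong refl) (simp only: expo_add c_def, simp add: algebra_simps)
    have int: "integrable M (\<lambda>x. u x * of_real (f (S x)) * expo \<xi> x)" for \<xi>
      unfolding * using linear.prems
      by (intro Bochner_Integration.integrable_sum integrable_mult_right
          Bochner_Integration.integrable_diff integrable_mult_expo sets) auto
    moreover have "(LINT x|M. u x * of_real (f (S x)) * expo \<xi> x) = 0" for \<xi>
    proof -
      note int = integrable_mult_expo[OF sets linear.prems(1)]
      have "(LINT x|M. c i * (u x * expo (a i + \<xi>) x - u x * expo (- a i + \<xi>) x)) = 0" for i
        by (simp only: integral_mult_right_zero Bochner_Integration.integral_diff[OF int int] linear.prems(2))
          simp
      moreover have "integrable M (\<lambda>x. c i * (u x * expo (a i + \<xi>) x - u x * expo (- a i + \<xi>) x))" for i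
        by (intro integrable_mult_right Bochner_Integration.integrable_diff int)
      ultimately show ?thesis
        unfolding * by (simp only: Bochner_Integration.integral_sum sum.neutral_const)
    qed
    ultimately show ?case
      using int[of 0] by simp
  next
    case (const c)
    have "(LINT x|M. u x * of_real c * expo \<xi> x) = of_real c * (LINT x|M. u x * expo \<xi> x)" for \<xi>
      by (subst integral_mult_right_zero[symmetric]) (simp add: mult_ac)
    then show ?case using const by simp
  next
    case (add f g)
    note f = add.IH(1)[OF add.prems] and g = add.IH(2)[OF add.prems]
    have "(LINT x|M. u x * of_real (f (S x)) * expo \<xi> x + u x * of_real (g (S x)) * expo \<xi> x) = 0" for \<xi>
      using f g by (subst Bochner_Integration.integral_add) (auto intro!: integrable_mult_expo sets)
    moreover have "integrable M (\<lambda>x. u x * of_real (f (S x)) + u x * of_real (g (S x)))"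
      using f g by auto
    ultimately show ?case by (simp add: algebra_simps)
  next
    case (mult f g)
    note f = mult.IH(1)[OF mult.prems]
    have "integrable M (\<lambda>x. (u x * of_real (f (S x))) * of_real (g (S x))) \<and>
      (\<forall>\<xi>. (LINT x|M. (u x * of_real (f (S x))) * of_real (g (S x)) * expo \<xi> x) = 0)"
      using f by (intro mult.IH(2)) auto
    then show ?case by (simp add: mult_ac)
  qed
  then show "integrable M (\<lambda>x. u x * of_real (p (\<chi> i. T * sin (x $ i / T))))"
    and "(LINT x|M. u x * of_real (p (\<chi> i. T * sin (x $ i / T))) * expo \<xi> x) = 0"
    unfolding S_def by auto
qed

lemma integrable_mult_bounded:
  fixes u :: "real^'n \<Rightarrow> complex" and g :: "real^'n \<Rightarrow> real"
  assumes sets: "sets M = sets borel" and u: "integrable M u"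
    and g: "g \<in> borel_measurable borel" "\<And>x. \<bar>g x\<bar> \<le> K"
  shows "integrable M (\<lambda>x. u x * of_real (g x))"
proof -
  note measurable_cong_sets[OF sets refl, simp]
  have [measurable]: "u \<in> borel_measurable borel" "g \<in> borel_measurable borel"
    using borel_measurable_integrable[OF u] g by simp_all
  show ?thesis
  proof (rule Bochner_Integration.integrable_bound[where f = "\<lambda>x. of_real K * u x"])
    have "cmod (u x) * \<bar>g x\<bar> \<le> \<bar>K\<bar> * cmod (u x)" for x
      using g(2)[of x] by (metis abs_ge_self mult.commute mult_left_mono norm_ge_zero order_trans)
    then show "AE x in M. cmod (u x * of_real (g x)) \<le> cmod (of_real K * u x)"
      by (simp add: norm_mult)
  qed (use u in auto)
qed

text \<open>The sines confine the argument of \<open>g\<close> to the compact box of half-width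
  \<open>T\<close>, wherever \<open>x\<close> lies. On that box \<open>g\<close> is a uniform limit
  of polynomials, and for polynomials the integral is already known to vanish.\<close>

lemma integral_continuous_sin_eq_0:
  fixes M :: "(real^'n) measure" and g :: "real^'n \<Rightarrow> real"
  assumes sets: "sets M = sets borel" and g: "continuous_on UNIV g" and T: "T > 0"
    and u: "integrable M u" "\<And>\<xi>. (LINT x|M. u x * expo \<xi> x) = 0"
  shows "(LINT x|M. u x * of_real (g (\<chi> i. T * sin (x $ i / T)))) = 0"
proof -
  define S :: "real^'n \<Rightarrow> real^'n" where "S x = (\<chi> i. T * sin (x $ i / T))" for x
  define Q :: "(real^'n) set" where "Q = cbox (\<chi> i. - T) (\<chi> i. T)"
  have SQ: "S x \<in> Q" for x
  proof -
    have "\<bar>T * sin (x $ i / T)\<bar> \<le> T" for i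
      using T by (simp add: abs_mult abs_sin_le_one mult_left_le)
    then show ?thesis
      unfolding Q_def S_def mem_box_cart by (auto simp: abs_le_iff) (metis minus_le_iff)
  qed
  have "compact Q" by (simp add: Q_def)
  have contS: "continuous_on UNIV S"
    unfolding S_def using T by (intro continuous_intros) auto
  have gS: "continuous_on UNIV (\<lambda>x. g (S x))"
    by (rule continuous_on_compose2[OF g contS]) auto
  have "bounded (g ` Q)"
    by (intro compact_imp_bounded compact_continuous_image continuous_on_subset[OF g] \<open>compact Q\<close>) auto
  then obtain K where "\<And>x. x \<in> Q \<Longrightarrow> \<bar>g x\<bar> \<le> K"
    unfolding bounded_iff by auto
  then have int_g: "integrable M (\<lambda>x. u x * of_real (g (S x)))"
    using SQ borel_measurable_continuous_onI[OF gS]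
    by (intro integrable_mult_bounded[OF sets u(1), of _ K]) auto
  have le: "cmod (LINT x|M. u x * of_real (g (S x))) \<le> e * (LINT x|M. cmod (u x))" if "e > 0" for e
  proof -
    obtain p where p: "real_polynomial_function p" "\<And>x. x \<in> Q \<Longrightarrow> \<bar>g x - p x\<bar> < e"
      using Stone_Weierstrass_real_polynomial_function[OF \<open>compact Q\<close> continuous_on_subset[OF g] \<open>e > 0\<close>]
      by auto
    note P = integral_polynomial_sin_eq_0[OF sets p(1) less_imp_neq[OF T, symmetric] u, folded S_def]
    have "(LINT x|M. u x * of_real (g (S x))) = (LINT x|M. u x * of_real (g (S x))) - (LINT x|M. u x * of_real (p (S x)))"
      using P(2)[of 0] by simp
    also have "\<dots> = (LINT x|M. u x * of_real (g (S x)) - u x * of_real (p (S x)))"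
      using int_g P(1) by simp
    finally have eq: "(LINT x|M. u x * of_real (g (S x))) = \<dots>" .
    have "cmod \<dots> \<le> (LINT x|M. cmod (u x * of_real (g (S x)) - u x * of_real (p (S x))))"
      by (rule integral_norm_bound)
    also have "\<dots> \<le> (LINT x|M. e * cmod (u x))"
    proof (rule integral_mono)
      fix x
      have "cmod (u x * of_real (g (S x)) - u x * of_real (p (S x))) = cmod (u x) * \<bar>g (S x) - p (S x)\<bar>"
        by (simp add: norm_mult flip: right_diff_distrib of_real_diff)
      also have "\<dots> \<le> cmod (u x) * e"
        using p(2)[OF SQ[of x]] by (intro mult_left_mono) auto
      finally show "cmod (u x * of_real (g (S x)) - u x * of_real (p (S x))) \<le> e * cmod (u x)"
        by (simp add: mult.commute)
    qed (use int_g P(1) u in auto)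
    finally show ?thesis using eq by simp
  qed
  have "cmod (LINT x|M. u x * of_real (g (S x))) \<le> 0"
  proof (rule field_le_epsilon)
    fix e :: real assume "e > 0"
    have I: "0 \<le> (LINT x|M. cmod (u x))" by simp
    \<comment> \<open>Adding 1 to the L1 norm of \<open>u\<close> keeps the denominator positive
      even if that norm is 0.\<close>
    have "cmod (LINT x|M. u x * of_real (g (S x))) \<le> e / (1 + (LINT x|M. cmod (u x))) * (LINT x|M. cmod (u x))"
      using \<open>e > 0\<close> I by (intro le) (simp add: add_pos_nonneg)
    also have "\<dots> \<le> e"
      using \<open>e > 0\<close> I by (simp add: pos_divide_le_eq add_pos_nonneg algebra_simps)
    finally show "cmod (LINT x|M. u x * of_real (g (S x))) \<le> 0 + e" by simp
  qed
  then show ?thesis by (simp add: S_def)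
qed

lemma tendsto_scaled_sin: "(\<lambda>k. real (Suc k) * sin (t / real (Suc k))) \<longlonglongrightarrow> t"
proof (cases "t = 0")
  case False
  have "(\<lambda>k. t / real (Suc k)) \<longlonglongrightarrow> 0"
    using tendsto_mult[OF tendsto_const[of t] LIMSEQ_inverse_real_of_nat] by (simp add: divide_inverse)
  then have "filterlim (\<lambda>k. t / real (Suc k)) (at 0) sequentially"
    using False by (auto simp: filterlim_at)
  then have "(\<lambda>k. sin (t / real (Suc k)) / (t / real (Suc k))) \<longlonglongrightarrow> 1"
    by (rule filterlim_compose[OF sinc_at_0])
  from tendsto_mult[OF tendsto_const[of t] this] show ?thesis
    using False by (simp add: mult.commute del: of_nat_Suc)
qed simp

text \<open>The scale of the sines tends to infinity, so \<open>S k x\<close> tends to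
  \<open>x\<close>. The bound on \<open>g\<close> supplies the integrable majorant for dominated
  convergence.\<close>

lemma integral_bounded_continuous_eq_0:
  fixes M :: "(real^'n) measure" and g :: "real^'n \<Rightarrow> real"
  assumes sets: "sets M = sets borel" and g: "continuous_on UNIV g" "\<And>x. \<bar>g x\<bar> \<le> K"
    and u: "integrable M u" "\<And>\<xi>. (LINT x|M. u x * expo \<xi> x) = 0"
  shows "(LINT x|M. u x * of_real (g x)) = 0"
proof -
  note measurable_cong_sets[OF sets refl, simp]
  define S :: "nat \<Rightarrow> real^'n \<Rightarrow> real^'n" where "S k x = (\<chi> i. real (Suc k) * sin (x $ i / real (Suc k)))" for k x
  have contS: "continuous_on UNIV (S k)" for k
    unfolding S_def by (intro continuous_intros) auto
  have [measurable]: "u \<in> borel_measurable borel" "g \<in> borel_measurable borel" "S k \<in> borel_measurable borel" for k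
    using borel_measurable_integrable[OF u(1)] borel_measurable_continuous_onI[OF g(1)]
      borel_measurable_continuous_onI[OF contS] by simp_all
  have "(\<lambda>k. LINT x|M. u x * of_real (g (S k x))) \<longlonglongrightarrow> (LINT x|M. u x * of_real (g x))"
  proof (rule integral_dominated_convergence[where w = "\<lambda>x. cmod (u x) * K"])
    have "(\<lambda>k. S k x) \<longlonglongrightarrow> x" for x
      unfolding S_def by (rule vec_tendstoI) (simp add: tendsto_scaled_sin del: of_nat_Suc)
    then show "AE x in M. (\<lambda>k. u x * of_real (g (S k x))) \<longlonglongrightarrow> u x * of_real (g x)"
      using g(1) by (intro AE_I2 tendsto_intros isCont_tendsto_compose[where g = g])
        (auto simp: continuous_on_eq_continuous_at)
    show "AE x in M. cmod (u x * of_real (g (S k x))) \<le> cmod (u x) * K" for k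
      using g(2) by (intro AE_I2) (auto simp: norm_mult intro!: mult_left_mono)
  qed (use u in auto)
  moreover have "(LINT x|M. u x * of_real (g (S k x))) = 0" for k
    unfolding S_def using integral_continuous_sin_eq_0[OF sets g(1) _ u, of "real (Suc k)"] by simp
  ultimately show ?thesis
    by (simp add: LIMSEQ_const_iff)
qed

text \<open>A point outside a closed set has positive distance to it, so the cut-off functions
  eventually vanish there. The empty set is excluded since \<open>setdist\<close> to it is 0 by
  convention, which would make every cut-off constantly 1.\<close>

lemma tendsto_indicator_closed:
  fixes C :: "'a::euclidean_space set"
  assumes "closed C" "C \<noteq> {}"
  shows "(\<lambda>k. max 0 (1 - real k * setdist {x} C)) \<longlonglongrightarrow> indicator C x"
proof (cases "x \<in> C")
  case True
  then show ?thesis by (simp add: setdist_eq_0I[of x])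
next
  case False
  then have "setdist {x} C > 0"
    using setdist_eq_0_closed[OF assms(1), of x] assms(2) setdist_pos_le[of "{x}" C] by (auto simp: less_le)
  then obtain k0 where k0: "1 < real k0 * setdist {x} C"
    using reals_Archimedean3 by blast
  have "max 0 (1 - real k * setdist {x} C) = 0" if "k \<ge> k0" for k
  proof -
    have "real k0 * setdist {x} C \<le> real k * setdist {x} C"
      using that by (intro mult_right_mono) auto
    then show ?thesis using k0 by simp
  qed
  then have "eventually (\<lambda>k. max 0 (1 - real k * setdist {x} C) = 0) sequentially"
    unfolding eventually_sequentially by blast
  then show ?thesis
    using False by (simp add: tendsto_eventually)
qed

text \<open>Approximating indicators by continuous functions shows that \<open>u\<close> integrates
  to 0 over every closed set. Closed sets are stable under intersection and generate the Borel sets,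
  so a Dynkin class argument extends this to all Borel sets, which forces \<open>u\<close> to vanish
  almost everywhere.\<close>

theorem AE_zero_if_fourier_zero:
  fixes M :: "(real^'n) measure"
  assumes "finite_measure M" and sets: "sets M = sets borel"
    and u: "integrable M u" "\<And>\<xi>. (LINT x|M. u x * expo \<xi> x) = 0"
  shows "AE x in M. u x = 0"
proof -
  interpret finite_measure M by fact
  note measurable_cong_sets[OF sets refl, simp]
  have [measurable]: "u \<in> borel_measurable borel"
    using borel_measurable_integrable[OF u(1)] by simp
  have closed: "set_lebesgue_integral M C u = 0" if "closed C" for C
  proof (cases "C = {}")
    case False
    define g where "g k x = max 0 (1 - real k * setdist {x} C)" for k x
    have cont: "continuous_on UNIV (g k)" for k
      unfolding g_def by (intro continuous_intros)
    have g1: "\<bar>g k x\<bar> \<le> 1" for k x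
      by (auto simp: g_def max_def setdist_pos_le)
    have [measurable]: "g k \<in> borel_measurable borel" "C \<in> sets borel" for k
      using borel_measurable_continuous_onI[OF cont] that by auto
    have "(\<lambda>k. LINT x|M. u x * of_real (g k x)) \<longlonglongrightarrow> (LINT x|M. u x * of_real (indicator C x))"
    proof (rule integral_dominated_convergence[where w = "\<lambda>x. cmod (u x)"])
      show "AE x in M. (\<lambda>k. u x * of_real (g k x)) \<longlonglongrightarrow> u x * of_real (indicator C x)"
        unfolding g_def using tendsto_indicator_closed[OF that False] by (intro AE_I2 tendsto_intros)
      show "AE x in M. cmod (u x * of_real (g k x)) \<le> cmod (u x)" for k
        using g1 by (intro AE_I2) (auto simp: norm_mult intro!: mult_left_le)
    qed (use u in auto)
    moreover have "(LINT x|M. u x * of_real (g k x)) = 0" for k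
      by (rule integral_bounded_continuous_eq_0[OF sets cont g1 u])
    ultimately have "(LINT x|M. u x * of_real (indicator C x)) = 0"
      by (simp add: LIMSEQ_const_iff)
    then show ?thesis
      by (simp add: set_lebesgue_integral_def scaleR_conv_of_real mult.commute)
  qed (simp add: set_lebesgue_integral_def)
  have set_int: "set_integrable M A u" if "A \<in> sets borel" for A
    using that sets u(1) unfolding set_integrable_def by (intro integrable_mult_indicator) auto
  have stable: "Int_stable (Collect closed :: (real^'n) set set)"
    by (auto simp: Int_stable_def)
  have Pow_UNIV_subset: "(Collect closed :: (real^'n) set set) \<subseteq> Pow UNIV"
    by simp
  have "set_lebesgue_integral M A u = 0" if "A \<in> sets M" for A
  proof -
    from that have "A \<in> sigma_sets UNIV (Collect closed)"
      by (simp add: sets borel_eq_closed)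
    from stable Pow_UNIV_subset this show "set_lebesgue_integral M A u = 0"
    proof (induction rule: sigma_sets_induct_disjoint)
      case (compl A)
      then have A: "A \<in> sets borel" by (simp add: borel_eq_closed)
      have "set_lebesgue_integral M (A \<union> (UNIV - A)) u = set_lebesgue_integral M A u + set_lebesgue_integral M (UNIV - A) u"
        using A by (intro set_integral_Un set_int) auto
      moreover have "A \<union> (UNIV - A) = UNIV" by auto
      ultimately show ?case
        using closed[of UNIV] compl by simp
    next
      case (union A)
      then have A: "A i \<in> sets borel" for i by (auto simp: borel_eq_closed)
      have "set_lebesgue_integral M (\<Union>i. A i) u = (\<Sum>i. set_lebesgue_integral M (A i) u)"
        using union A sets
        by (intro lebesgue_integral_countable_add set_int) (auto simp: disjoint_family_on_def)
      then show ?case using union by simp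
    qed (auto simp: closed)
  qed
  then show ?thesis
    by (rule density_zero[OF u(1)])
qed

section \<open>Fourier transforms of discrete convolutions and masks\<close>

text \<open>The coordinates are independent under \<open>Pi_pmf\<close>, and finite supports make
  every function integrable.\<close>

lemma integral_prod_Pi_pmf:
  fixes h :: "'a \<Rightarrow> 'b \<Rightarrow> complex"
  assumes "finite I" "\<And>i. i \<in> I \<Longrightarrow> finite (set_pmf (p i))"
  shows "(LINT a|measure_pmf (Pi_pmf I d p). (\<Prod>i\<in>I. h i (a i))) = (\<Prod>i\<in>I. LINT x|measure_pmf (p i). h i x)"
proof -
  have "finite (set_pmf (Pi_pmf I d p))"
    using assms by (auto simp: set_Pi_pmf intro!: finite_PiE_dflt)
  then have "(LINT a|measure_pmf (Pi_pmf I d p). (\<Prod>i\<in>I. h i (a i))) =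
      (\<Prod>i\<in>I. LINT a|measure_pmf (Pi_pmf I d p). h i (a i))"
    using assms
    by (intro prob_space.indep_vars_lebesgue_integral
        prob_space.indep_vars_compose2[OF _ indep_vars_Pi_pmf]
        integrable_measure_pmf_finite measure_pmf.prob_space_axioms) auto
  also have "\<dots> = (\<Prod>i\<in>I. LINT x|measure_pmf (map_pmf (\<lambda>a. a i) (Pi_pmf I d p)). h i x)"
    by simp
  also have "\<dots> = (\<Prod>i\<in>I. LINT x|measure_pmf (p i). h i x)"
    using assms(1) by (intro prod.cong refl) (subst Pi_pmf_component, simp_all)
  finally show ?thesis .
qed

lemma cis_sum: "cis (\<Sum>i\<in>I. f i) = (\<Prod>i\<in>I. cis (f i))"
  by (induction I rule: infinite_finite_induct) (simp_all add: cis_mult[symmetric])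

text \<open>A character of a sum of independent variables is a product of characters, so the
  transform of the convolution is a product of averages over the sets \<open>A i\<close>.\<close>

lemma fourier_conv_deltas:
  assumes "\<And>i. i \<in> {1..k} \<Longrightarrow> finite (A i) \<and> A i \<noteq> {}"
  shows "fourier (conv_deltas A k) \<xi> = (\<Prod>i=1..k. (\<Sum>a\<in>A i. cis (- 2 * pi * (\<xi> \<bullet> a))) / of_nat (card (A i)))"
proof -
  have [measurable]: "(\<lambda>x. cis (- (2 * pi * (\<xi> \<bullet> x)))) \<in> borel_measurable borel"
    unfolding cis_conv_exp by measurable
  have "fourier (conv_deltas A k) \<xi> =
    (LINT a|measure_pmf (Pi_pmf {1..k} 0 (\<lambda>i. pmf_of_set (A i))). (\<Prod>i=1..k. cis (- 2 * pi * (\<xi> \<bullet> a i))))"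
    unfolding fourier_def conv_deltas_def
    by (subst integral_distr) (auto simp: inner_sum_right sum_distrib_left simp flip: cis_sum sum_negf)
  also have "\<dots> = (\<Prod>i=1..k. LINT x|measure_pmf (pmf_of_set (A i)). cis (- 2 * pi * (\<xi> \<bullet> x)))"
    using assms by (intro integral_prod_Pi_pmf) (auto simp: set_pmf_of_set)
  also have "\<dots> = (\<Prod>i=1..k. (\<Sum>a\<in>A i. cis (- 2 * pi * (\<xi> \<bullet> a))) / of_nat (card (A i)))"
    using assms
    by (intro prod.cong refl, subst integral_measure_pmf[of "A i" for i])
      (auto simp: set_pmf_of_set sum_divide_distrib scaleR_conv_of_real)
  finally show ?thesis .
qed

lemma borel_prob_conv_deltas: "borel_prob (conv_deltas A k)"
  unfolding borel_prob_def conv_deltas_def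
  by (auto intro!: prob_space.prob_space_distr measure_pmf.prob_space_axioms)

lemma fourier_expo: "fourier M \<xi> = (LINT x|M. expo (- \<xi>) x)"
  by (simp add: fourier_def expo_def)

lemma borel_prob_integrable_expo:
  assumes "borel_prob M"
  shows "integrable M (expo \<xi>)"
proof -
  interpret prob_space M using assms by (simp add: borel_prob_def)
  have "integrable M (\<lambda>x. 1 * expo \<xi> x)"
    using assms by (intro integrable_mult_expo) (auto simp: borel_prob_def)
  then show ?thesis by simp
qed

lemma fourier_zero [simp]:
  assumes "borel_prob M"
  shows "fourier M 0 = 1"
proof -
  interpret prob_space M using assms by (simp add: borel_prob_def)
  show ?thesis by (simp add: fourier_expo prob_space)
qed

text \<open>Weak convergence is tested on real functions, so the real and imaginary parts are
  treated separately as integrals of a cosine and of a negated sine.\<close>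

lemma weak_conv_fourier:
  assumes "weak_conv M N" "\<And>k. borel_prob (M k)" "borel_prob N"
  shows "(\<lambda>k. fourier (M k) \<xi>) \<longlonglongrightarrow> fourier N \<xi>"
proof -
  have Re: "Re (fourier M \<xi>) = (LINT x|M. cos (2 * pi * (\<xi> \<bullet> x)))"
    and Im: "Im (fourier M \<xi>) = (LINT x|M. - sin (2 * pi * (\<xi> \<bullet> x)))"
    if "borel_prob M" for M :: "(real^'a) measure"
    unfolding fourier_expo using borel_prob_integrable_expo[OF that, of "- \<xi>"]
    by (simp_all flip: integral_Re integral_Im add: expo_def)
  have "bounded (range (\<lambda>x. cos (2 * pi * (\<xi> \<bullet> x))))" "bounded (range (\<lambda>x. - sin (2 * pi * (\<xi> \<bullet> x))))"
    by (auto simp: bounded_iff intro!: exI[of _ 1])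
  then have "(\<lambda>k. LINT x|M k. cos (2 * pi * (\<xi> \<bullet> x))) \<longlonglongrightarrow> (LINT x|N. cos (2 * pi * (\<xi> \<bullet> x)))"
    "(\<lambda>k. LINT x|M k. - sin (2 * pi * (\<xi> \<bullet> x))) \<longlonglongrightarrow> (LINT x|N. - sin (2 * pi * (\<xi> \<bullet> x)))"
    by (intro assms(1)[unfolded weak_conv_def, rule_format] conjI continuous_intros; simp)+
  then show ?thesis
    using assms(2,3) by (intro tendsto_complex_iff[THEN iffD2]) (simp add: Re Im)
qed

text \<open>For finite nonempty \<open>B\<close> this is the Fourier transform of the uniform
  probability measure on \<open>B\<close>; the transforms of the discrete convolutions are products
  of such masks at rescaled frequencies.\<close>

definition mask :: "(real^'n) set \<Rightarrow> real^'n \<Rightarrow> complex" where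
  "mask B \<eta> = (\<Sum>b\<in>B. cis (- 2 * pi * (\<eta> \<bullet> b))) / of_nat (card B)"

text \<open>The matrix moves from the points to the frequency by transposition:
  \<open>\<xi> v* C\<close> is the transpose of \<open>C\<close> applied to \<open>\<xi>\<close>.
  Injectivity preserves the cardinality and the sum.\<close>

lemma mask_image:
  assumes "inj ((*v) C)"
  shows "(\<Sum>a\<in>(\<lambda>b. C *v b) ` B. cis (- 2 * pi * (\<xi> \<bullet> a))) / of_nat (card ((\<lambda>b. C *v b) ` B)) = mask B (\<xi> v* C)"
proof -
  have inj: "inj_on ((*v) C) B" using assms by (rule inj_on_subset) simp
  show ?thesis
    unfolding mask_def by (simp add: card_image[OF inj] sum.reindex[OF inj] dot_lmul_matrix)
qed

section \<open>Integrality, periodicity and tightness of masks\<close>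

lemma int_vec_inner: "int_vec v \<Longrightarrow> int_vec w \<Longrightarrow> v \<bullet> w \<in> \<int>"
  by (auto simp: int_vec_def inner_vec_def intro!: Ints_sum Ints_mult)

lemma int_vec_add: "int_vec v \<Longrightarrow> int_vec w \<Longrightarrow> int_vec (v + w)"
  by (auto simp: int_vec_def)

lemma int_vec_diff: "int_vec v \<Longrightarrow> int_vec w \<Longrightarrow> int_vec (v - w)"
  by (auto simp: int_vec_def)

lemma int_vec_zero [simp]: "int_vec 0"
  by (simp add: int_vec_def)

lemma int_vec_vector_matrix: "int_vec v \<Longrightarrow> int_mat A \<Longrightarrow> int_vec (v v* A)"
  by (auto simp: int_vec_def int_mat_def vector_matrix_mult_def intro!: Ints_sum Ints_mult)

lemma int_mat_mult: "int_mat A \<Longrightarrow> int_mat C \<Longrightarrow> int_mat (A ** C)"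
  by (auto simp: int_mat_def matrix_matrix_mult_def intro!: Ints_sum Ints_mult)

lemma int_mat_one: "int_mat (mat 1)"
  by (auto simp: int_mat_def mat_def)

lemma cis_two_pi_Ints: "z \<in> \<int> \<Longrightarrow> cis (- 2 * pi * z) = 1"
proof -
  assume "z \<in> \<int>"
  then have "- z \<in> \<int>" by simp
  from cis_multiple_2pi[OF this] show ?thesis by simp
qed

text \<open>A character with integer frequency equals 1 at all integer points.\<close>

lemma mask_periodic:
  assumes "int_vec w" "\<And>b. b \<in> B \<Longrightarrow> int_vec b"
  shows "mask B (\<eta> + w) = mask B \<eta>"
proof -
  have "cis (- 2 * pi * ((\<eta> + w) \<bullet> b)) = cis (- 2 * pi * (\<eta> \<bullet> b))" if "b \<in> B" for b
  proof -
    have "cis (- 2 * pi * ((\<eta> + w) \<bullet> b)) = cis (- 2 * pi * (\<eta> \<bullet> b)) * cis (- 2 * pi * (w \<bullet> b))"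
      by (simp add: cis_mult inner_add_left algebra_simps)
    then show ?thesis
      using cis_two_pi_Ints[OF int_vec_inner[OF assms(1) assms(2)[OF that]]] by simp
  qed
  then show ?thesis by (simp add: mask_def)
qed

text \<open>The mask values at the shifted frequencies are the coordinates of a unit vector after
  multiplication by a unitary matrix, so their squares sum to 1. Having 0 in \<open>L\<close> later
  ensures that enlarging a tight set keeps its old points.\<close>

lemma admissible_mask_tight:
  assumes "admissible R B"
  obtains L where "finite L" "\<And>l. l \<in> L \<Longrightarrow> int_vec l" "0 \<in> L"
    "\<And>\<eta>. (\<Sum>l\<in>L. (cmod (mask B (\<eta> + l v* matrix_inv R)))\<^sup>2) = 1"
proof -
  define U where "U b l = complex_of_real (1 / sqrt (real (card B))) *
      cis (- 2 * pi * ((matrix_inv R *v b) \<bullet> l))" for b l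
  have "\<exists>L. finite L \<and> (\<forall>l\<in>L. int_vec l) \<and> card L = card B \<and>
      (\<forall>b\<in>B. \<forall>b'\<in>B. (\<Sum>l\<in>L. U b l * cnj (U b' l)) = (if b = b' then 1 else 0))"
    using assms unfolding admissible_def Let_def U_def
    by (elim conjE exE, intro exI conjI) assumption+
  then obtain L where L: "finite L" "\<And>l. l \<in> L \<Longrightarrow> int_vec l" "card L = card B"
    and U: "\<And>b b'. b \<in> B \<Longrightarrow> b' \<in> B \<Longrightarrow> (\<Sum>l\<in>L. U b l * cnj (U b' l)) = (if b = b' then 1 else 0)"
    by blast
  have B: "finite B" "B \<noteq> {}" using assms by (simp_all add: admissible_def)
  define N where "N = card B"
  have N: "N > 0" using B by (auto simp: N_def card_gt_0_iff)
  have sum1: "(\<Sum>l\<in>L. (cmod (mask B (\<eta> + l v* matrix_inv R)))\<^sup>2) = 1" for \<eta>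
  proof -
    \<comment> \<open>One factor of modulus 1 / sqrt N goes into \<open>e\<close>, the other into
      \<open>U\<close>; thus \<open>e\<close> is a vector of norm 1.\<close>
    define e where "e b = cis (- 2 * pi * (\<eta> \<bullet> b)) / of_real (sqrt (real N))" for b
    have m: "mask B (\<eta> + l v* matrix_inv R) = (\<Sum>b\<in>B. e b * U b l)" for l
    proof -
      have "cis (- 2 * pi * ((\<eta> + l v* matrix_inv R) \<bullet> b)) / of_nat N = e b * U b l" for b
      proof -
        have "complex_of_real (sqrt (real N)) * complex_of_real (sqrt (real N)) = of_nat N"
          using N by (simp flip: of_real_mult)
        moreover have "cis (- 2 * pi * ((\<eta> + l v* matrix_inv R) \<bullet> b)) =
            cis (- 2 * pi * (\<eta> \<bullet> b)) * cis (- 2 * pi * ((matrix_inv R *v b) \<bullet> l))"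
          by (simp add: cis_mult inner_add_left dot_lmul_matrix inner_commute[of _ l] algebra_simps)
        ultimately show ?thesis
          by (simp add: e_def U_def flip: N_def)
      qed
      then show ?thesis by (simp add: mask_def sum_divide_distrib flip: N_def)
    qed
    have e: "e b * cnj (e b) = 1 / of_nat N" for b
    proof -
      have "e b * cnj (e b) = complex_of_real ((cmod (e b))\<^sup>2)" by (simp only: complex_norm_square)
      also have "(cmod (e b))\<^sup>2 = 1 / real N"
        by (simp add: e_def norm_divide power_divide)
      finally show ?thesis by simp
    qed
    have "complex_of_real (\<Sum>l\<in>L. (cmod (mask B (\<eta> + l v* matrix_inv R)))\<^sup>2) =
        (\<Sum>l\<in>L. (\<Sum>b\<in>B. e b * U b l) * cnj (\<Sum>b\<in>B. e b * U b l))"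
      by (simp only: m of_real_sum complex_norm_square)
    also have "\<dots> = (\<Sum>l\<in>L. \<Sum>b\<in>B. \<Sum>b'\<in>B. e b * cnj (e b') * (U b l * cnj (U b' l)))"
      by (simp add: sum_product cnj_sum mult_ac)
    \<comment> \<open>With the sum over \<open>L\<close> innermost, orthonormality of the rows of
      \<open>U\<close> leaves only the diagonal terms.\<close>
    also have "\<dots> = (\<Sum>b\<in>B. \<Sum>b'\<in>B. e b * cnj (e b') * (\<Sum>l\<in>L. U b l * cnj (U b' l)))"
      by (subst sum.swap, rule sum.cong[OF refl], subst sum.swap) (simp add: sum_distrib_left)
    also have "\<dots> = (\<Sum>b\<in>B. \<Sum>b'\<in>B. if b = b' then e b * cnj (e b') else 0)"
      by (intro sum.cong refl) (simp add: U)
    also have "\<dots> = (\<Sum>b\<in>B. 1 / of_nat N)"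
      using B by (simp add: sum.delta e)
    also have "\<dots> = 1" using N by (simp add: N_def)
    finally show ?thesis using of_real_eq_1_iff by blast
  qed
  have "L \<noteq> {}" using L(3) B by auto
  then obtain l0 where l0: "l0 \<in> L" by blast
  \<comment> \<open>Subtracting \<open>l0\<close> brings 0 into the set and only replaces
    \<open>\<eta>\<close> by a translate, which is harmless because the identity holds for every
    \<open>\<eta>\<close>.\<close>
  show thesis
  proof (rule that[of "(\<lambda>l. l - l0) ` L"])
    show "0 \<in> (\<lambda>l. l - l0) ` L" using l0 by force
    show "int_vec l" if "l \<in> (\<lambda>l. l - l0) ` L" for l
      using that L(2) l0 by (auto intro!: int_vec_diff)
    show "(\<Sum>l\<in>(\<lambda>l. l - l0) ` L. (cmod (mask B (\<eta> + l v* matrix_inv R)))\<^sup>2) = 1" for \<eta>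
    proof -
      have "(l - l0) v* matrix_inv R = l v* matrix_inv R - l0 v* matrix_inv R" for l
        using vector_matrix_left_distrib[of "l - l0" l0 "matrix_inv R"] by simp
      then show ?thesis
        using sum1[of "\<eta> - l0 v* matrix_inv R"]
        by (subst sum.reindex) (auto simp: inj_on_def algebra_simps)
    qed
  qed (use L in auto)
qed

section \<open>Tight frequency sets\<close>

text \<open>For a Borel probability measure this is Parseval's identity for every character, i.e.
  the finite set is a spectrum of \<open>M\<close>.\<close>

definition tight :: "(real^'n) measure \<Rightarrow> (real^'n) set \<Rightarrow> bool" where
  "tight M \<Lambda> \<longleftrightarrow> finite \<Lambda> \<and> (\<forall>\<xi>. (\<Sum>l\<in>\<Lambda>. (cmod (fourier M (\<xi> + l)))\<^sup>2) = 1)"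

text \<open>At \<open>\<xi> = - h j\<close> the term with index \<open>j\<close> is already 1, so
  all others vanish. Indexing by \<open>I\<close> instead of summing over the image leaves the
  injectivity of \<open>h\<close> to be derived rather than assumed.\<close>

lemma tight_family_orthogonal:
  assumes "borel_prob M" "finite I" "\<And>\<xi>. (\<Sum>i\<in>I. (cmod (fourier M (\<xi> + h i)))\<^sup>2) = 1"
    and "i \<in> I" "j \<in> I" "i \<noteq> j"
  shows "fourier M (h i - h j) = 0"
proof -
  have "1 = (\<Sum>k\<in>I. (cmod (fourier M (- h j + h k)))\<^sup>2)"
    by (rule assms(3)[symmetric])
  also have "\<dots> = (cmod (fourier M (- h j + h j)))\<^sup>2 + (\<Sum>k\<in>I - {j}. (cmod (fourier M (- h j + h k)))\<^sup>2)"
    using assms by (intro sum.remove)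
  finally have "(\<Sum>k\<in>I - {j}. (cmod (fourier M (- h j + h k)))\<^sup>2) = 0"
    using assms(1) by simp
  then have "\<forall>k\<in>I - {j}. (cmod (fourier M (- h j + h k)))\<^sup>2 = 0"
    using assms(2) by (subst (asm) sum_nonneg_eq_0_iff) auto
  then show ?thesis using assms by auto
qed

text \<open>Two indices with the same value would give \<open>fourier M 0 = 0\<close>, whereas it is
  1. Hence \<open>h\<close> is injective and the sum over \<open>I\<close> is a sum over the
  image.\<close>

lemma tight_image:
  assumes "borel_prob M" "finite I" "\<And>\<xi>. (\<Sum>i\<in>I. (cmod (fourier M (\<xi> + h i)))\<^sup>2) = 1"
  shows "tight M (h ` I)"
proof -
  have "inj_on h I"
    using tight_family_orthogonal[OF assms] assms(1) by (fastforce simp: inj_on_def)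
  then show ?thesis
    unfolding tight_def using assms by (simp add: sum.reindex)
qed

lemma tight_orthogonal:
  assumes "borel_prob M" "tight M \<Lambda>" "l \<in> \<Lambda>" "l' \<in> \<Lambda>" "l \<noteq> l'"
  shows "fourier M (l - l') = 0"
  using assms(2) by (intro tight_family_orthogonal[OF assms(1) _ _ assms(3-5)]) (auto simp: tight_def)

section \<open>Matrix inverses and the norm of a transpose\<close>

lemma matrix_inv_unique:
  fixes A :: "real^'n^'n"
  assumes "A ** C = mat 1"
  shows "matrix_inv A = C"
proof -
  have "C ** A = mat 1" using assms matrix_left_right_inverse by blast
  have inv: "A ** matrix_inv A = mat 1 \<and> matrix_inv A ** A = mat 1"
    unfolding matrix_inv_def
    by (rule someI[where x = C]) (use assms \<open>C ** A = mat 1\<close> in simp)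
  have "matrix_inv A = (C ** A) ** matrix_inv A" using \<open>C ** A = mat 1\<close> by simp
  also have "\<dots> = C ** (A ** matrix_inv A)" by (rule matrix_mul_assoc[symmetric])
  also have "\<dots> = C" using inv by simp
  finally show ?thesis .
qed

lemma matrix_inv_right:
  fixes A :: "real^'n^'n"
  assumes "invertible A"
  shows "A ** matrix_inv A = mat 1"
proof -
  obtain C where "A ** C = mat 1" using assms unfolding invertible_def by blast
  with matrix_inv_unique[OF this] show ?thesis by simp
qed

lemma matrix_inv_mult:
  fixes A C :: "real^'n^'n"
  assumes "invertible A" "invertible C"
  shows "matrix_inv (A ** C) = matrix_inv C ** matrix_inv A"
proof (rule matrix_inv_unique)
  have "A ** C ** (matrix_inv C ** matrix_inv A) = A ** (C ** matrix_inv C) ** matrix_inv A"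
    by (simp add: matrix_mul_assoc)
  then show "A ** C ** (matrix_inv C ** matrix_inv A) = mat 1"
    using assms by (simp add: matrix_inv_right)
qed

text \<open>Since 0 does not have modulus greater than 1, it is not an eigenvalue; evaluating the
  characteristic determinant at 0 gives the determinant of \<open>- R\<close>.\<close>

lemma expanding_imp_invertible:
  fixes R :: "real^'n^'n"
  assumes "expanding R"
  shows "invertible R"
proof -
  have "det (mat 0 - (\<chi> i j. complex_of_real (R $ i $ j))) \<noteq> 0"
    using assms unfolding expanding_def by (metis norm_zero not_one_less_zero)
  moreover have "det (mat 0 - (\<chi> i j. complex_of_real (R $ i $ j))) = of_real (det (- R))"
    by (simp add: det_def mat_def)
  ultimately have "invertible (- R)" by (simp add: invertible_det_nz)
  then obtain C where "- R ** C = mat 1" "C ** (- R) = mat 1" unfolding invertible_def by blast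
  then have "R ** (- C) = mat 1" "(- C) ** R = mat 1"
    by (simp_all add: matrix_matrix_mult_def vec_eq_iff)
  then show ?thesis unfolding invertible_def by blast
qed

lemma inj_matrix_inv:
  fixes A :: "real^'n^'n"
  assumes "invertible A"
  shows "inj ((*v) (matrix_inv A))"
proof (rule inj_on_inverseI)
  show "A *v (matrix_inv A *v x) = x" for x
    using matrix_inv_right[OF assms] by (simp add: matrix_vector_mul_assoc)
qed

text \<open>The norm hypothesis concerns matrices acting on points, while frequencies are moved by
  transposes. The squared norm of \<open>v v* A\<close> is the inner product of \<open>v\<close>
  with \<open>A *v (v v* A)\<close>; Cauchy-Schwarz and cancellation finish.\<close>

lemma norm_vector_matrix_le:
  fixes A :: "real^'n^'n"
  shows "norm (v v* A) \<le> norm v * onorm ((*v) A)"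
proof (cases "norm (v v* A) = 0")
  case True
  then show ?thesis by (simp add: onorm_pos_le[OF matrix_vector_mul_bounded_linear])
next
  case False
  have "norm (v v* A) * norm (v v* A) = v \<bullet> (A *v (v v* A))"
    by (metis dot_lmul_matrix norm_eq_sqrt_inner real_sqrt_mult_self inner_ge_zero abs_of_nonneg)
  also have "\<dots> \<le> norm v * norm (A *v (v v* A))"
    by (rule norm_cauchy_schwarz)
  also have "\<dots> \<le> norm v * (onorm ((*v) A) * norm (v v* A))"
    by (intro mult_left_mono onorm[OF matrix_vector_mul_bounded_linear]) simp
  finally have "norm (v v* A) * norm (v v* A) \<le> (norm v * onorm ((*v) A)) * norm (v v* A)"
    by (simp add: mult_ac)
  with False show ?thesis by (simp add: mult_le_cancel_right)
qed

section \<open>Sequences of admissible pairs\<close>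

locale admissible_sequence =
  fixes R :: "nat \<Rightarrow> real^'n^'n" and B :: "nat \<Rightarrow> (real^'n) set"
  assumes admissible: "\<And>n. n \<ge> 1 \<Longrightarrow> admissible (R n) (B n)"
begin

lemma invertible_R: "n \<ge> 1 \<Longrightarrow> invertible (R n)"
  using admissible expanding_imp_invertible unfolding admissible_def by blast

lemma B_finite: "n \<ge> 1 \<Longrightarrow> finite (B n)" and B_nonempty: "n \<ge> 1 \<Longrightarrow> B n \<noteq> {}"
  and B_int: "n \<ge> 1 \<Longrightarrow> b \<in> B n \<Longrightarrow> int_vec b"
  using admissible unfolding admissible_def by blast+

lemma invertible_tailprod: "invertible (tailprod R m k)"
proof (induction k)
  case 0
  show ?case by (auto simp: invertible_def intro!: exI[of _ "mat 1"])
qed (simp add: invertible_mult invertible_R)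

lemma int_mat_tailprod: "int_mat (tailprod R m k)"
  using admissible by (induction k) (auto simp: int_mat_one admissible_def intro!: int_mat_mult)

lemma tailprod_add: "tailprod R m (k + j) = tailprod R (m + k) j ** tailprod R m k"
  by (induction j) (auto simp: matrix_mul_assoc add_ac)

lemma invprod_eq: "invprod R n = matrix_inv (tailprod R 0 n)"
proof (induction n)
  case 0
  show ?case by (simp add: matrix_inv_unique)
next
  case (Suc n)
  then show ?case by (simp add: matrix_inv_mult invertible_R invertible_tailprod)
qed

lemma invprod_add: "invprod R (n + k) = invprod R n ** matrix_inv (tailprod R n k)"
  unfolding invprod_eq tailprod_add by (simp add: matrix_inv_mult invertible_tailprod)

text \<open>The first \<open>n\<close> factors cancel. What remains is again a product of integer
  matrices, the fact behind the periodicity of the transforms.\<close>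

lemma tailprod_invprod: "tailprod R 0 (n + k) ** invprod R n = tailprod R n k"
  unfolding invprod_eq tailprod_add
  by (simp add: matrix_inv_right invertible_tailprod flip: matrix_mul_assoc)

section \<open>Product formulas and the factorisation of the limit transform\<close>

lemma fourier_mu_n: "fourier (mu_n R B n) \<xi> = (\<Prod>i=1..n. mask (B i) (\<xi> v* invprod R i))"
  unfolding mu_n_def invprod_eq
  by (subst fourier_conv_deltas, simp add: B_finite B_nonempty)
    (simp only: mask_image[OF inj_matrix_inv[OF invertible_tailprod]])

text \<open>At the rescaled frequency the inverse products compose to
  \<open>invprod R (n + i)\<close>, so these are exactly the factors of the full convolution with
  indices from \<open>n + 1\<close> to \<open>n + k\<close>.\<close>

lemma fourier_nu_tail:
  "fourier (nu_tail R B n k) (\<xi> v* invprod R n) = (\<Prod>i=1..k. mask (B (n + i)) (\<xi> v* invprod R (n + i)))"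
  unfolding nu_tail_def invprod_add
  by (subst fourier_conv_deltas, simp add: B_finite B_nonempty)
    (simp only: mask_image[OF inj_matrix_inv[OF invertible_tailprod]] vector_matrix_mul_assoc)

lemma fourier_mu_n_add:
  "fourier (mu_n R B (n + k)) \<xi> = fourier (mu_n R B n) \<xi> * fourier (nu_tail R B n k) (\<xi> v* invprod R n)"
proof -
  have "(\<Prod>i=n+1..n+k. mask (B i) (\<xi> v* invprod R i)) = (\<Prod>i=1..k. mask (B (n + i)) (\<xi> v* invprod R (n + i)))"
    using prod.shift_bounds_cl_nat_ivl[of "\<lambda>i. mask (B i) (\<xi> v* invprod R i)" 1 n k] by (simp add: add_ac)
  moreover have "(\<Prod>i=1..n+k. mask (B i) (\<xi> v* invprod R i)) =
      (\<Prod>i=1..n. mask (B i) (\<xi> v* invprod R i)) * (\<Prod>i=n+1..n+k. mask (B i) (\<xi> v* invprod R i))"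
    by (rule prod.ub_add_nat) simp
  ultimately show ?thesis
    unfolding fourier_mu_n fourier_nu_tail by simp
qed

text \<open>The finite factorisation is passed to the limit in \<open>k\<close> with
  \<open>n\<close> fixed.\<close>

lemma fourier_limit_factor:
  assumes "borel_prob \<mu>" "weak_conv (mu_n R B) \<mu>" "borel_prob \<nu>" "weak_conv (nu_tail R B n) \<nu>"
  shows "fourier \<mu> \<xi> = fourier (mu_n R B n) \<xi> * fourier \<nu> (\<xi> v* invprod R n)"
proof (rule LIMSEQ_unique)
  have "(\<lambda>k. fourier (mu_n R B k) \<xi>) \<longlonglongrightarrow> fourier \<mu> \<xi>"
    by (rule weak_conv_fourier[OF assms(2) _ assms(1)]) (simp add: mu_n_def borel_prob_conv_deltas)
  then show "(\<lambda>k. fourier (mu_n R B (k + n)) \<xi>) \<longlonglongrightarrow> fourier \<mu> \<xi>"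
    by (rule LIMSEQ_ignore_initial_segment)
  have "(\<lambda>k. fourier (nu_tail R B n k) (\<xi> v* invprod R n)) \<longlonglongrightarrow> fourier \<nu> (\<xi> v* invprod R n)"
    by (rule weak_conv_fourier[OF assms(4) _ assms(3)]) (simp add: nu_tail_def borel_prob_conv_deltas)
  then show "(\<lambda>k. fourier (mu_n R B (k + n)) \<xi>) \<longlonglongrightarrow> fourier (mu_n R B n) \<xi> * fourier \<nu> (\<xi> v* invprod R n)"
    unfolding add.commute[of _ n] fourier_mu_n_add by (intro tendsto_intros)
qed

text \<open>For \<open>i \<le> n\<close> the rescaling by \<open>invprod R i\<close> still leaves
  the shift an integer vector, which the \<open>i\<close>-th mask does not see.\<close>

lemma fourier_mu_n_periodic:
  assumes "int_vec k"
  shows "fourier (mu_n R B n) (\<xi> + k v* tailprod R 0 n) = fourier (mu_n R B n) \<xi>"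
  unfolding fourier_mu_n
proof (intro prod.cong refl)
  fix i assume i: "i \<in> {1..n}"
  have "(k v* tailprod R 0 n) v* invprod R i = k v* tailprod R i (n - i)"
    using tailprod_invprod[of i "n - i"] i by (simp add: vector_matrix_mul_assoc)
  then have "(\<xi> + k v* tailprod R 0 n) v* invprod R i = \<xi> v* invprod R i + k v* tailprod R i (n - i)"
    by (simp add: vector_matrix_left_distrib)
  then show "mask (B i) ((\<xi> + k v* tailprod R 0 n) v* invprod R i) = mask (B i) (\<xi> v* invprod R i)"
    using i mask_periodic[OF int_vec_vector_matrix[OF assms int_mat_tailprod] B_int[of i]] by simp
qed

text \<open>The new frequencies are \<open>l + k v* tailprod R 0 n\<close> with \<open>k\<close> in
  the set \<open>L\<close> attached to the next pair. The first \<open>n\<close> masks ignore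
  \<open>k\<close> by periodicity, and the squares of the last mask sum to 1 over \<open>k\<close>.
  Since 0 is in \<open>L\<close>, the old frequencies survive.\<close>

lemma tight_extend_Suc:
  assumes "tight (mu_n R B n) \<Lambda>" "\<And>l. l \<in> \<Lambda> \<Longrightarrow> int_vec l"
  shows "\<exists>\<Lambda>'. tight (mu_n R B (Suc n)) \<Lambda>' \<and> \<Lambda> \<subseteq> \<Lambda>' \<and> (\<forall>l\<in>\<Lambda>'. int_vec l)"
proof -
  obtain L where L: "finite L" "\<And>l. l \<in> L \<Longrightarrow> int_vec l" "0 \<in> L"
    "\<And>\<eta>. (\<Sum>l\<in>L. (cmod (mask (B (Suc n)) (\<eta> + l v* matrix_inv (R (Suc n)))))\<^sup>2) = 1"
    using admissible_mask_tight[OF admissible[of "Suc n"]] by auto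
  define h where "h = (\<lambda>(l, k). l + k v* tailprod R 0 n)"
  have "tight (mu_n R B (Suc n)) (h ` (\<Lambda> \<times> L))"
  proof (rule tight_image)
    show "borel_prob (mu_n R B (Suc n))"
      by (simp add: mu_n_def borel_prob_conv_deltas)
    show "finite (\<Lambda> \<times> L)" using assms L by (simp add: tight_def)
    fix \<xi>
    have eq: "fourier (mu_n R B (Suc n)) (\<xi> + h (l, k)) = fourier (mu_n R B n) (\<xi> + l) *
        mask (B (Suc n)) ((\<xi> + l) v* invprod R (Suc n) + k v* matrix_inv (R (Suc n)))" if "k \<in> L" for l k
    proof -
      have "tailprod R 0 n ** invprod R (Suc n) = matrix_inv (R (Suc n))"
        by (simp add: invprod_eq matrix_inv_right invertible_tailprod matrix_mul_assoc)
      then have "(\<xi> + h (l, k)) v* invprod R (Suc n) = (\<xi> + l) v* invprod R (Suc n) + k v* matrix_inv (R (Suc n))"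
        by (simp add: h_def vector_matrix_left_distrib vector_matrix_mul_assoc add.assoc del: invprod.simps)
      moreover have "fourier (mu_n R B n) (\<xi> + h (l, k)) = fourier (mu_n R B n) (\<xi> + l)"
        using fourier_mu_n_periodic[OF L(2)[OF that], of n "\<xi> + l"] by (simp add: h_def add.assoc)
      ultimately show ?thesis
        by (simp add: fourier_mu_n del: invprod.simps)
    qed
    have "(\<Sum>i\<in>\<Lambda> \<times> L. (cmod (fourier (mu_n R B (Suc n)) (\<xi> + h i)))\<^sup>2) =
        (\<Sum>l\<in>\<Lambda>. \<Sum>k\<in>L. (cmod (fourier (mu_n R B (Suc n)) (\<xi> + h (l, k))))\<^sup>2)"
      by (simp add: sum.cartesian_product)
    also have "\<dots> = (\<Sum>l\<in>\<Lambda>. (cmod (fourier (mu_n R B n) (\<xi> + l)))\<^sup>2)"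
      by (intro sum.cong refl)
        (simp add: eq norm_mult power_mult_distrib L(4) del: invprod.simps flip: sum_distrib_left)
    also have "\<dots> = 1" using assms by (simp add: tight_def)
    finally show "(\<Sum>i\<in>\<Lambda> \<times> L. (cmod (fourier (mu_n R B (Suc n)) (\<xi> + h i)))\<^sup>2) = 1" .
  qed
  moreover have "\<Lambda> \<subseteq> h ` (\<Lambda> \<times> L)"
    using L(3) by (force simp: h_def)
  moreover have "\<forall>l\<in>h ` (\<Lambda> \<times> L). int_vec l"
    using assms L(2) by (auto simp: h_def intro!: int_vec_add int_vec_vector_matrix int_mat_tailprod)
  ultimately show ?thesis by blast
qed

lemma tight_extend:
  assumes "n \<le> m" "tight (mu_n R B n) \<Lambda>" "\<And>l. l \<in> \<Lambda> \<Longrightarrow> int_vec l"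
  shows "\<exists>\<Lambda>'. tight (mu_n R B m) \<Lambda>' \<and> \<Lambda> \<subseteq> \<Lambda>' \<and> (\<forall>l\<in>\<Lambda>'. int_vec l)"
  using assms(1)
proof (induction m rule: dec_induct)
  case base
  then show ?case using assms by blast
next
  case (step m)
  then show ?case using tight_extend_Suc by (meson order_trans)
qed

text \<open>Periodicity leaves every term of the sum unchanged, although each point may have its own
  shift; \<open>tight_image\<close> rules out collisions.\<close>

lemma tight_translate:
  assumes "tight (mu_n R B n) \<Lambda>" "\<And>l. l \<in> \<Lambda> \<Longrightarrow> int_vec (t l)"
  shows "tight (mu_n R B n) ((\<lambda>l. l + t l v* tailprod R 0 n) ` \<Lambda>)"
proof (rule tight_image)
  show "borel_prob (mu_n R B n)"
    by (simp add: mu_n_def borel_prob_conv_deltas)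
  show "(\<Sum>l\<in>\<Lambda>. (cmod (fourier (mu_n R B n) (\<xi> + (l + t l v* tailprod R 0 n))))\<^sup>2) = 1" for \<xi>
    using assms by (simp add: fourier_mu_n_periodic tight_def flip: add.assoc)
qed (use assms in \<open>auto simp: tight_def\<close>)

end

section \<open>Completeness\<close>

lemma fourier_uminus: "fourier M (- \<xi>) = cnj (fourier M \<xi>)"
proof -
  have "cnj (LINT x|M. expo (- \<xi>) x) = (LINT x|M. cnj (expo (- \<xi>) x))"
    by (rule Bochner_Integration.integral_cnj[symmetric])
  then show ?thesis by (simp add: fourier_expo cnj_expo)
qed

lemma integral_expo: "(LINT x|M. expo \<xi> x) = fourier M (- \<xi>)"
  by (simp add: fourier_expo)

lemma norm_fourier_le_1:
  assumes "borel_prob M"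
  shows "cmod (fourier M \<xi>) \<le> 1"
proof -
  interpret prob_space M using assms by (simp add: borel_prob_def)
  have "cmod (fourier M \<xi>) \<le> (LINT x|M. cmod (expo (- \<xi>) x))"
    unfolding fourier_expo by (rule integral_norm_bound)
  then show ?thesis by (simp add: prob_space)
qed

text \<open>The coefficient \<open>fourier M (l - \<eta>)\<close> is the inner product of
  \<open>expo \<eta>\<close> with \<open>expo l\<close>. So \<open>g\<close> is the residual of an
  orthogonal projection, and its norm is given by Pythagoras.\<close>

lemma orthonormal_residual:
  fixes \<eta> :: "real^'n"
  assumes M: "borel_prob M" and F: "finite F"
    and orth: "\<And>l l'. l \<in> F \<Longrightarrow> l' \<in> F \<Longrightarrow> l \<noteq> l' \<Longrightarrow> fourier M (l - l') = 0"
  defines "g \<equiv> \<lambda>x. expo \<eta> x - (\<Sum>l\<in>F. fourier M (l - \<eta>) * expo l x)"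
  shows "integrable M (\<lambda>x. (cmod (g x))\<^sup>2)"
    and "(LINT x|M. (cmod (g x))\<^sup>2) = 1 - (\<Sum>l\<in>F. (cmod (fourier M (l - \<eta>)))\<^sup>2)"
proof -
  interpret prob_space M using M by (simp add: borel_prob_def)
  define \<alpha> where "\<alpha> l = fourier M (l - \<eta>)" for l
  define p where "p x = (\<Sum>l\<in>F. \<alpha> l * expo (l - \<eta>) x)" for x
  define q where "q x = (\<Sum>l\<in>F. cnj (\<alpha> l) * expo (\<eta> - l) x)" for x
  define r where "r x = (\<Sum>l\<in>F. \<Sum>l'\<in>F. \<alpha> l * cnj (\<alpha> l') * expo (l - l') x)" for x
  note int = borel_prob_integrable_expo[OF M]
  have split: "expo (a - b) x = expo a x * expo (- b) x" for a b x
    using expo_add[of a "- b" x] by simp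
  have one: "expo a x * expo (- a) x = 1" for a x
    using expo_add[of a "- a" x] by simp
  \<comment> \<open>The cross terms \<open>p\<close>, \<open>q\<close> and the quadratic term
    \<open>r\<close> will all have the same integral, the sum of the squared coefficients, so
    exactly one copy remains subtracted.\<close>
  have eq: "complex_of_real ((cmod (g x))\<^sup>2) = 1 - p x - q x + r x" for x
  proof -
    have "complex_of_real ((cmod (g x))\<^sup>2) =
        (expo \<eta> x - (\<Sum>l\<in>F. \<alpha> l * expo l x)) * (expo (- \<eta>) x - (\<Sum>l\<in>F. cnj (\<alpha> l) * expo (- l) x))"
      by (simp only: complex_norm_square g_def \<alpha>_def complex_cnj_diff cnj_sum complex_cnj_mult cnj_expo)
    also have "\<dots> = expo \<eta> x * expo (- \<eta>) x - (\<Sum>l\<in>F. \<alpha> l * expo l x) * expo (- \<eta>) x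
        - expo \<eta> x * (\<Sum>l\<in>F. cnj (\<alpha> l) * expo (- l) x)
        + (\<Sum>l\<in>F. \<alpha> l * expo l x) * (\<Sum>l\<in>F. cnj (\<alpha> l) * expo (- l) x)"
      by (simp only: algebra_simps)
    also have "\<dots> = 1 - p x - q x + r x"
    proof -
      have "(\<Sum>l\<in>F. \<alpha> l * expo l x) * (\<Sum>l\<in>F. cnj (\<alpha> l) * expo (- l) x) = r x"
        unfolding r_def split sum_product by (simp only: mult_ac)
      moreover have "(\<Sum>l\<in>F. \<alpha> l * expo l x) * expo (- \<eta>) x = p x"
        "expo \<eta> x * (\<Sum>l\<in>F. cnj (\<alpha> l) * expo (- l) x) = q x"
        unfolding p_def q_def split sum_distrib_left sum_distrib_right by (simp_all only: mult_ac)
      ultimately show ?thesis by (simp only: one)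
    qed
    finally show ?thesis .
  qed
  have "integrable M p" "integrable M q" "integrable M r"
    unfolding p_def[abs_def] q_def[abs_def] r_def[abs_def]
    by (intro Bochner_Integration.integrable_sum integrable_mult_right int)+
  then have "integrable M (\<lambda>x. complex_of_real ((cmod (g x))\<^sup>2))"
    unfolding eq by simp
  then show "integrable M (\<lambda>x. (cmod (g x))\<^sup>2)"
    by (simp only: complex_of_real_integrable_eq)
  have sq: "\<alpha> l * cnj (\<alpha> l) = complex_of_real ((cmod (\<alpha> l))\<^sup>2)" for l
    by (simp only: complex_norm_square)
  have cnj_\<alpha>: "fourier M (\<eta> - l) = cnj (\<alpha> l)" for l
    using fourier_uminus[of M "l - \<eta>"] by (simp add: \<alpha>_def)
  have Ip: "(LINT x|M. p x) = complex_of_real (\<Sum>l\<in>F. (cmod (\<alpha> l))\<^sup>2)"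
  proof -
    have "(LINT x|M. p x) = (\<Sum>l\<in>F. \<alpha> l * fourier M (\<eta> - l))"
      unfolding p_def using int by (simp add: Bochner_Integration.integral_sum integral_expo)
    then show ?thesis by (simp only: cnj_\<alpha> sq of_real_sum)
  qed
  have Iq: "(LINT x|M. q x) = complex_of_real (\<Sum>l\<in>F. (cmod (\<alpha> l))\<^sup>2)"
  proof -
    have "(LINT x|M. q x) = (\<Sum>l\<in>F. cnj (\<alpha> l) * \<alpha> l)"
      unfolding q_def using int by (simp add: Bochner_Integration.integral_sum integral_expo \<alpha>_def)
    then show ?thesis by (simp only: mult.commute[of "cnj _"] sq of_real_sum)
  qed
  have Ir: "(LINT x|M. r x) = complex_of_real (\<Sum>l\<in>F. (cmod (\<alpha> l))\<^sup>2)"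
  proof -
    have "(LINT x|M. r x) = (\<Sum>l\<in>F. \<Sum>l'\<in>F. \<alpha> l * cnj (\<alpha> l') * fourier M (l' - l))"
      unfolding r_def using int by (simp add: Bochner_Integration.integral_sum integral_expo)
    also have "\<dots> = (\<Sum>l\<in>F. \<Sum>l'\<in>F. if l = l' then \<alpha> l * cnj (\<alpha> l') else 0)"
      using M by (intro sum.cong refl) (auto simp: orth)
    also have "\<dots> = (\<Sum>l\<in>F. \<alpha> l * cnj (\<alpha> l))"
      using F by simp
    finally show ?thesis by (simp add: sq)
  qed
  have "complex_of_real (LINT x|M. (cmod (g x))\<^sup>2) = (LINT x|M. complex_of_real ((cmod (g x))\<^sup>2))"
    by (rule integral_complex_of_real[symmetric])
  also have "\<dots> = (LINT x|M. 1) - (LINT x|M. p x) - (LINT x|M. q x) + (LINT x|M. r x)"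
    unfolding eq using \<open>integrable M p\<close> \<open>integrable M q\<close> \<open>integrable M r\<close> by simp
  also have "\<dots> = complex_of_real (1 - (\<Sum>l\<in>F. (cmod (\<alpha> l))\<^sup>2))"
    unfolding Ip Iq Ir by (simp add: prob_space)
  finally show "(LINT x|M. (cmod (g x))\<^sup>2) = 1 - (\<Sum>l\<in>F. (cmod (fourier M (l - \<eta>)))\<^sup>2)"
    unfolding \<alpha>_def using of_real_eq_iff by blast
qed

text \<open>A weighted arithmetic-geometric mean inequality in place of Cauchy-Schwarz. It is
  applied with the squared norm of \<open>g\<close> at most \<open>t\<^sup>2\<close>, so that both
  terms are of order \<open>t\<close>.\<close>

lemma norm_integral_mult_le:
  fixes f g :: "'a \<Rightarrow> complex"
  assumes "f \<in> borel_measurable M" "g \<in> borel_measurable M" "t > 0"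
    and "integrable M (\<lambda>x. (cmod (f x))\<^sup>2)" "integrable M (\<lambda>x. (cmod (g x))\<^sup>2)"
  shows "cmod (LINT x|M. f x * g x) \<le> t * (LINT x|M. (cmod (f x))\<^sup>2) + (LINT x|M. (cmod (g x))\<^sup>2) / t"
proof -
  have le: "cmod (f x * g x) \<le> t * (cmod (f x))\<^sup>2 + (cmod (g x))\<^sup>2 / t" for x
  proof -
    have "0 \<le> (t * cmod (f x) - cmod (g x))\<^sup>2" by simp
    then have "2 * (t * (cmod (f x) * cmod (g x))) \<le> t * (t * (cmod (f x))\<^sup>2) + (cmod (g x))\<^sup>2"
      by (simp add: power2_eq_square algebra_simps)
    moreover have "0 \<le> t * (cmod (f x) * cmod (g x))" using assms(3) by simp
    ultimately have "t * (cmod (f x) * cmod (g x)) \<le> t * (t * (cmod (f x))\<^sup>2) + (cmod (g x))\<^sup>2"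
      by linarith
    also have "\<dots> = t * (t * (cmod (f x))\<^sup>2 + (cmod (g x))\<^sup>2 / t)"
      using assms(3) by (simp add: algebra_simps)
    finally show ?thesis
      using assms(3) by (simp add: norm_mult mult_le_cancel_left)
  qed
  have int: "integrable M (\<lambda>x. t * (cmod (f x))\<^sup>2 + (cmod (g x))\<^sup>2 / t)"
    using assms by simp
  have "integrable M (\<lambda>x. f x * g x)"
    using assms(1,2) le
    by (intro Bochner_Integration.integrable_bound[OF int]) (auto intro: order_trans[OF _ abs_ge_self])
  have "cmod (LINT x|M. f x * g x) \<le> (LINT x|M. cmod (f x * g x))"
    by (rule integral_norm_bound)
  also have "\<dots> \<le> (LINT x|M. t * (cmod (f x))\<^sup>2 + (cmod (g x))\<^sup>2 / t)"
    using \<open>integrable M (\<lambda>x. f x * g x)\<close> int le by (intro integral_mono) auto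
  also have "\<dots> = t * (LINT x|M. (cmod (f x))\<^sup>2) + (LINT x|M. (cmod (g x))\<^sup>2) / t"
    using assms by simp
  finally show ?thesis .
qed

text \<open>The Jorgensen-Pedersen criterion.\<close>

lemma is_spectrum_if_parseval:
  fixes M :: "(real^'n) measure"
  assumes M: "borel_prob M" and "countable \<Lambda>"
    and orth: "\<And>l l'. l \<in> \<Lambda> \<Longrightarrow> l' \<in> \<Lambda> \<Longrightarrow> l \<noteq> l' \<Longrightarrow> fourier M (l - l') = 0"
    and parseval: "\<And>\<xi> \<delta>. \<delta> > 0 \<Longrightarrow>
      \<exists>F. finite F \<and> F \<subseteq> \<Lambda> \<and> 1 - \<delta> \<le> (\<Sum>l\<in>F. (cmod (fourier M (\<xi> + l)))\<^sup>2)"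
  shows "is_spectrum M \<Lambda>"
  unfolding is_spectrum_def
proof (intro conjI ballI allI impI)
  show "countable \<Lambda>" by fact
  show "(LINT x|M. expo l x * cnj (expo l' x)) = (if l = l' then 1 else 0)" if "l \<in> \<Lambda>" "l' \<in> \<Lambda>" for l l'
    using orth[OF that(2,1)] M
    by (auto simp: cnj_expo expo_add[symmetric] integral_expo)
next
  fix f :: "real^'n \<Rightarrow> complex"
  assume "f \<in> borel_measurable M \<and> integrable M (\<lambda>x. (cmod (f x))\<^sup>2) \<and>
      (\<forall>l\<in>\<Lambda>. (LINT x|M. f x * cnj (expo l x)) = 0)"
  then have f: "f \<in> borel_measurable M" "integrable M (\<lambda>x. (cmod (f x))\<^sup>2)"
    and f0: "\<And>l. l \<in> \<Lambda> \<Longrightarrow> (LINT x|M. f x * expo (- l) x) = 0"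
    by (auto simp: cnj_expo)
  interpret prob_space M using M by (simp add: borel_prob_def)
  have sets: "sets M = sets borel" using M by (simp add: borel_prob_def)
  have [measurable]: "expo \<xi> \<in> borel_measurable M" for \<xi> :: "real^'n"
    unfolding measurable_cong_sets[OF sets refl] by measurable
  \<comment> \<open>On a probability space square integrability implies integrability, as needed for
    the uniqueness theorem.\<close>
  have int_f: "integrable M f"
  proof (rule Bochner_Integration.integrable_bound)
    show "integrable M (\<lambda>x. 1 + (cmod (f x))\<^sup>2)" using f by simp
    have "c \<le> 1 + c\<^sup>2" for c :: real
      using zero_le_power2[of "c - 1/2"] by (simp add: power2_eq_square algebra_simps)
    then show "AE x in M. cmod (f x) \<le> norm (1 + (cmod (f x))\<^sup>2)"
      by (intro AE_I2) (auto intro: order_trans[OF _ abs_ge_self])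
  qed (fact f)
  define K where "K = (LINT x|M. (cmod (f x))\<^sup>2)"
  have "(LINT x|M. f x * expo \<xi> x) = 0" for \<xi>
  proof -
    \<comment> \<open>The tolerance \<open>t\<^sup>2\<close> makes the squared norm of the residual
      of \<open>expo (- \<xi>)\<close> at most \<open>t\<^sup>2\<close>. As \<open>f\<close> is
      orthogonal to the projection, only the residual contributes.\<close>
    have bound: "cmod (LINT x|M. f x * expo \<xi> x) \<le> t * (K + 1)" if t: "t > 0" for t
    proof -
      obtain F where F: "finite F" "F \<subseteq> \<Lambda>" "1 - t\<^sup>2 \<le> (\<Sum>l\<in>F. (cmod (fourier M (\<xi> + l)))\<^sup>2)"
        using parseval[of "t\<^sup>2" \<xi>] t by auto
      define g where "g x = expo (- \<xi>) x - (\<Sum>l\<in>F. fourier M (l - (- \<xi>)) * expo l x)" for x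
      have "g \<in> borel_measurable M"
        unfolding g_def[abs_def] by measurable
      then have "(\<lambda>x. cnj (g x)) \<in> borel_measurable M"
        by (rule measurable_compose) (intro borel_measurable_continuous_onI continuous_intros)
      have g: "integrable M (\<lambda>x. (cmod (g x))\<^sup>2)"
        "(LINT x|M. (cmod (g x))\<^sup>2) = 1 - (\<Sum>l\<in>F. (cmod (fourier M (l - (- \<xi>))))\<^sup>2)"
        unfolding g_def using F orth by (intro orthonormal_residual[OF M F(1)]; blast)+
      have "f x * cnj (g x) = f x * expo \<xi> x - (\<Sum>l\<in>F. cnj (fourier M (l - (- \<xi>))) * (f x * expo (- l) x))" for x
        by (simp add: g_def cnj_expo sum_distrib_left algebra_simps)
      then have "(LINT x|M. f x * cnj (g x)) =
          (LINT x|M. f x * expo \<xi> x) - (\<Sum>l\<in>F. cnj (fourier M (l - (- \<xi>))) * (LINT x|M. f x * expo (- l) x))"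
        using integrable_mult_expo[OF sets int_f] by (simp add: Bochner_Integration.integral_sum)
      also have "\<dots> = (LINT x|M. f x * expo \<xi> x)"
        using f0 F(2) by (simp add: subset_iff)
      finally have "cmod (LINT x|M. f x * expo \<xi> x) = cmod (LINT x|M. f x * cnj (g x))" by simp
      also have "\<dots> \<le> t * (LINT x|M. (cmod (f x))\<^sup>2) + (LINT x|M. (cmod (cnj (g x)))\<^sup>2) / t"
        using f g that \<open>(\<lambda>x. cnj (g x)) \<in> borel_measurable M\<close> by (intro norm_integral_mult_le) auto
      also have "\<dots> \<le> t * K + t\<^sup>2 / t"
        using g(2) F(3) that by (intro add_mono divide_right_mono) (auto simp: K_def add.commute)
      also have "\<dots> = t * (K + 1)"
        using that by (simp add: power2_eq_square algebra_simps)
      finally show ?thesis .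
    qed
    have "cmod (LINT x|M. f x * expo \<xi> x) \<le> 0"
    proof (rule field_le_epsilon)
      fix e :: real assume "e > 0"
      have "K \<ge> 0" by (simp add: K_def)
      then have "0 < e / (K + 1)" "e / (K + 1) * (K + 1) = e"
        using \<open>e > 0\<close> by auto
      then show "cmod (LINT x|M. f x * expo \<xi> x) \<le> 0 + e"
        using bound[of "e / (K + 1)"] by simp
    qed
    then show ?thesis by simp
  qed
  then show "AE x in M. f x = 0"
    by (intro AE_zero_if_fourier_zero[OF finite_measure_axioms sets int_f])
qed

text \<open>A discrete dominated convergence argument: mass cannot escape to infinity because
  \<open>d k\<close> is dominated by a multiple of the summable limit \<open>c\<close>.\<close>

lemma limit_mass_one:
  fixes c :: "'a \<Rightarrow> real" and d :: "nat \<Rightarrow> 'a \<Rightarrow> real"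
  assumes fin: "\<And>k. finite (\<Lambda> k)" and mono: "incseq \<Lambda>"
    and sum1: "\<And>k. (\<Sum>l\<in>\<Lambda> k. d k l) = 1"
    and nonneg: "\<And>l. 0 \<le> c l" and le: "\<And>k l. c l \<le> d k l"
    and e: "e > 0" "eventually (\<lambda>k. \<forall>l\<in>\<Lambda> k. e * d k l \<le> c l) sequentially"
    and lim: "\<And>l. (\<lambda>k. d k l) \<longlonglongrightarrow> c l"
    and "\<delta> > 0"
  shows "\<exists>k. 1 - \<delta> \<le> (\<Sum>l\<in>\<Lambda> k. c l)"
proof -
  define a where "a k = (\<Sum>l\<in>\<Lambda> k. c l)" for k
  have "incseq a"
    unfolding a_def incseq_def using mono fin nonneg by (auto simp: incseq_def intro!: sum_mono2)
  moreover have "a k \<le> 1" for k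
    unfolding a_def sum1[of k, symmetric] using le by (intro sum_mono)
  ultimately have "convergent a"
    using incseq_convergent[of a 1] by (metis convergentI)
  then have "Cauchy a" by (rule convergent_Cauchy)
  \<comment> \<open>Beyond \<open>k0\<close> the mass of \<open>c\<close> on added points is below
    \<open>e * \<delta>\<close>, so by domination the mass of \<open>d k\<close> on them is at most
    \<open>\<delta>\<close>. What remains lives on the fixed finite set \<open>\<Lambda> k0\<close>,
    where the limit can be taken termwise.\<close>
  then obtain k0 where k0: "\<And>k. k \<ge> k0 \<Longrightarrow> \<bar>a k - a k0\<bar> < e * \<delta>"
    using e(1) \<open>\<delta> > 0\<close> unfolding Cauchy_def dist_real_def by (meson mult_pos_pos order_refl)
  have "eventually (\<lambda>k. 1 \<le> (\<Sum>l\<in>\<Lambda> k0. d k l) + \<delta>) sequentially"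
    using e(2) eventually_ge_at_top[of k0]
  proof eventually_elim
    case (elim k)
    have sub: "\<Lambda> k0 \<subseteq> \<Lambda> k" using mono elim by (simp add: incseq_def)
    have "e * (\<Sum>l\<in>\<Lambda> k - \<Lambda> k0. d k l) \<le> (\<Sum>l\<in>\<Lambda> k - \<Lambda> k0. c l)"
      unfolding sum_distrib_left using elim by (intro sum_mono) auto
    also have "\<dots> = a k - a k0"
      unfolding a_def using sub fin by (simp add: sum_diff)
    also have "\<dots> \<le> e * \<delta>" using k0[of k] elim by auto
    finally have "(\<Sum>l\<in>\<Lambda> k - \<Lambda> k0. d k l) \<le> \<delta>" using e(1) by simp
    moreover have "1 = (\<Sum>l\<in>\<Lambda> k - \<Lambda> k0. d k l) + (\<Sum>l\<in>\<Lambda> k0. d k l)"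
      unfolding sum1[of k, symmetric] using sub fin by (intro sum.subset_diff)
    ultimately show ?case by simp
  qed
  moreover have "(\<lambda>k. (\<Sum>l\<in>\<Lambda> k0. d k l) + \<delta>) \<longlonglongrightarrow> a k0 + \<delta>"
    unfolding a_def by (intro tendsto_intros lim)
  ultimately have "1 \<le> a k0 + \<delta>"
    by (intro tendsto_lowerbound) auto
  then show ?thesis unfolding a_def by (intro exI[of _ k0]) simp
qed

section \<open>Construction of the spectrum\<close>

context admissible_sequence
begin

lemma eventually_norm_invprod_less:
  assumes "(\<lambda>n. onorm (\<lambda>x. invprod R n *v x)) \<longlonglongrightarrow> 0" "\<gamma> > 0"
  shows "eventually (\<lambda>n. norm (\<xi> v* invprod R n) < \<gamma>) sequentially"
proof -
  have "(\<lambda>n. norm \<xi> * onorm (\<lambda>x. invprod R n *v x)) \<longlonglongrightarrow> norm \<xi> * 0"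
    by (intro tendsto_intros assms)
  then have "eventually (\<lambda>n. norm \<xi> * onorm (\<lambda>x. invprod R n *v x) < \<gamma>) sequentially"
    using assms(2) by (intro order_tendstoD(2)) auto
  then show ?thesis
    by eventually_elim (rule le_less_trans[OF norm_vector_matrix_le])
qed

text \<open>Here \<open>E\<close> is equi-positivity unfolded. The lower bound is claimed on radius
  \<open>\<gamma> / 2\<close> only: for old points the other half absorbs their rescaled position,
  and the remaining room is later used for the rescaled frequency \<open>\<xi>\<close>.\<close>

lemma tight_step:
  fixes nj :: "nat \<Rightarrow> nat" and \<nu> :: "nat \<Rightarrow> (real^'n) measure"
  assumes norm0: "(\<lambda>n. onorm (\<lambda>x. invprod R n *v x)) \<longlonglongrightarrow> 0"
    and nj: "strict_mono nj" and \<gamma>: "\<gamma> > 0"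
    and E: "\<forall>x. (\<forall>i. 0 \<le> x $ i \<and> x $ i < 1) \<longrightarrow> (\<forall>M\<in>range \<nu>. \<exists>k. int_vec k \<and> (x = 0 \<longrightarrow> k = 0) \<and>
        (\<forall>y. norm y < \<gamma> \<longrightarrow> \<epsilon> \<le> cmod (fourier M (x + y + k))))"
    and \<Lambda>: "tight (mu_n R B n) \<Lambda>" "\<And>l. l \<in> \<Lambda> \<Longrightarrow> int_vec l"
  shows "\<exists>j \<Lambda>'. j > j0 \<and> \<Lambda> \<subseteq> \<Lambda>' \<and> tight (mu_n R B (nj j)) \<Lambda>' \<and> (\<forall>l\<in>\<Lambda>'. int_vec l) \<and>
     (\<forall>l\<in>\<Lambda>'. \<forall>y. norm y < \<gamma> / 2 \<longrightarrow> \<epsilon> \<le> cmod (fourier (\<nu> j) (l v* invprod R (nj j) + y)))"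
proof -
  have equi: "\<exists>k. int_vec k \<and> (x = 0 \<longrightarrow> k = 0) \<and>
      (\<forall>y. norm y < \<gamma> \<longrightarrow> \<epsilon> \<le> cmod (fourier (\<nu> j) (x + y + k)))"
    if "\<And>i. 0 \<le> x $ i \<and> x $ i < 1" for x j
    using E[THEN spec[of _ x], THEN mp] that by simp
  have "finite \<Lambda>" using \<Lambda> by (simp add: tight_def)
  then have "eventually (\<lambda>m. \<forall>l\<in>\<Lambda>. norm (l v* invprod R m) < \<gamma> / 2) sequentially"
    using \<gamma> by (intro eventually_ball_finite ballI eventually_norm_invprod_less[OF norm0]) auto
  then have "eventually (\<lambda>j. \<forall>l\<in>\<Lambda>. norm (l v* invprod R (nj j)) < \<gamma> / 2) sequentially"
    using filterlim_subseq[OF nj] by (rule eventually_compose_filterlim)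
  moreover have "eventually (\<lambda>j. n \<le> nj j) sequentially"
    using filterlim_subseq[OF nj] by (simp add: filterlim_at_top)
  ultimately have "eventually (\<lambda>j. (\<forall>l\<in>\<Lambda>. norm (l v* invprod R (nj j)) < \<gamma> / 2) \<and> n \<le> nj j \<and> j > j0) sequentially"
    using eventually_gt_at_top[of j0] by eventually_elim blast
  then obtain j where j: "\<And>l. l \<in> \<Lambda> \<Longrightarrow> norm (l v* invprod R (nj j)) < \<gamma> / 2" "n \<le> nj j" "j > j0"
    unfolding eventually_sequentially by blast
  define Q where "Q = invprod R (nj j)"
  obtain \<Lambda>1 where \<Lambda>1: "tight (mu_n R B (nj j)) \<Lambda>1" "\<Lambda> \<subseteq> \<Lambda>1" "\<And>l. l \<in> \<Lambda>1 \<Longrightarrow> int_vec l"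
    using tight_extend[OF j(2) \<Lambda>] by blast
  \<comment> \<open>Old points rescale into a small ball about 0, where equi-positivity at
    \<open>x = 0\<close> allows the shift 0; other points need an integer shift in rescaled
    coordinates.\<close>
  have "\<exists>t. int_vec t \<and> (l \<in> \<Lambda> \<longrightarrow> t = 0) \<and>
      (\<forall>y. norm y < \<gamma> / 2 \<longrightarrow> \<epsilon> \<le> cmod (fourier (\<nu> j) (l v* Q + t + y)))" for l
  proof (cases "l \<in> \<Lambda>")
    case True
    obtain k where k: "k = 0" "\<And>y. norm y < \<gamma> \<Longrightarrow> \<epsilon> \<le> cmod (fourier (\<nu> j) (0 + y + k))"
      using equi[of 0 j] by auto
    have "\<epsilon> \<le> cmod (fourier (\<nu> j) (l v* Q + 0 + y))" if "norm y < \<gamma> / 2" for y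
    proof -
      have "norm (l v* Q + y) < \<gamma>"
        using norm_triangle_ineq[of "l v* Q" y] j(1)[OF True] that by (simp add: Q_def)
      from k(2)[OF this] show ?thesis using k(1) by simp
    qed
    then show ?thesis by (intro exI[of _ 0]) simp
  next
    case False
    define w where "w = l v* Q"
    \<comment> \<open>Equi-positivity speaks about the unit cube, so it is applied to the fractional
      part \<open>w - z\<close>. Relative to \<open>w\<close> the resulting shift is
      \<open>k - z\<close>.\<close>
    define z :: "real^'n" where "z = (\<chi> i. of_int \<lfloor>w $ i\<rfloor>)"
    have "0 \<le> (w - z) $ i \<and> (w - z) $ i < 1" for i
      by (simp add: z_def) linarith
    then obtain k where k: "int_vec k" "\<And>y. norm y < \<gamma> \<Longrightarrow> \<epsilon> \<le> cmod (fourier (\<nu> j) (w - z + y + k))"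
      using equi[of "w - z" j] by blast
    show ?thesis
    proof (intro exI[of _ "k - z"] conjI allI impI)
      show "int_vec (k - z)"
        using k(1) by (intro int_vec_diff) (auto simp: int_vec_def z_def)
      show "\<epsilon> \<le> cmod (fourier (\<nu> j) (l v* Q + (k - z) + y))" if "norm y < \<gamma> / 2" for y
        using k(2)[of y] that \<gamma> by (simp add: w_def algebra_simps)
    qed (use False in auto)
  qed
  then obtain t where t: "\<And>l. int_vec (t l)" "\<And>l. l \<in> \<Lambda> \<Longrightarrow> t l = 0"
      "\<And>l y. norm y < \<gamma> / 2 \<Longrightarrow> \<epsilon> \<le> cmod (fourier (\<nu> j) (l v* Q + t l + y))"
    by metis
  \<comment> \<open>Pulled back to the original scale, the shift \<open>t l\<close> is a period of
    the discrete transform, so tightness is preserved.\<close>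
  define h where "h l = l + t l v* tailprod R 0 (nj j)" for l
  have PQ: "tailprod R 0 (nj j) ** Q = mat 1"
    using tailprod_invprod[of "nj j" 0] by (simp add: Q_def)
  have hQ: "h l v* Q = l v* Q + t l" for l
    by (simp add: h_def vector_matrix_left_distrib vector_matrix_mul_assoc PQ)
  show ?thesis
  proof (intro exI conjI)
    show "j > j0" by fact
    show "\<Lambda> \<subseteq> h ` \<Lambda>1"
    proof
      fix l assume "l \<in> \<Lambda>"
      then have "h l = l" using t(2) by (simp add: h_def)
      with \<open>l \<in> \<Lambda>\<close> \<Lambda>1(2) show "l \<in> h ` \<Lambda>1" by (metis imageI subsetD)
    qed
    show "tight (mu_n R B (nj j)) (h ` \<Lambda>1)"
      unfolding h_def using \<Lambda>1 t(1) by (intro tight_translate)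
    show "\<forall>l\<in>h ` \<Lambda>1. int_vec l"
      using \<Lambda>1(3) t(1) by (auto simp: h_def intro!: int_vec_add int_vec_vector_matrix int_mat_tailprod)
    show "\<forall>l\<in>h ` \<Lambda>1. \<forall>y. norm y < \<gamma> / 2 \<longrightarrow> \<epsilon> \<le> cmod (fourier (\<nu> j) (l v* invprod R (nj j) + y))"
      using t(3) by (auto simp: hQ simp flip: Q_def)
  qed
qed

end

section \<open>Iteration along the subsequence and passage to the limit\<close>

theorem theorem1p1:
  fixes R :: "nat \<Rightarrow> real^'n^'n" and B :: "nat \<Rightarrow> (real^'n) set" and \<mu> :: "(real^'n) measure"
  assumes adm: "\<And>n. n \<ge> 1 \<Longrightarrow> admissible (R n) (B n)"
    and mu: "borel_prob \<mu>" "weak_conv (mu_n R B) \<mu>"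
    and norm0: "(\<lambda>n. onorm (\<lambda>x. invprod R n *v x)) \<longlonglongrightarrow> 0"
    and sub: "\<exists>nj :: nat \<Rightarrow> nat. \<exists>\<nu> :: nat \<Rightarrow> (real^'n) measure.
               strict_mono nj \<and> (\<forall>j. nj j \<ge> 1) \<and>
               (\<forall>j. borel_prob (\<nu> j) \<and> weak_conv (nu_tail R B (nj j)) (\<nu> j)) \<and>
               equi_positive (range \<nu>)"
  shows "spectral_measure \<mu> \<and> (\<exists>\<Lambda>. is_spectrum \<mu> \<Lambda> \<and> (\<forall>lam\<in>\<Lambda>. int_vec lam))"
proof -
  interpret admissible_sequence R B by unfold_locales (rule adm)
  obtain nj :: "nat \<Rightarrow> nat" and \<nu> where nj: "strict_mono nj" and \<nu>: "\<And>j. borel_prob (\<nu> j)"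
    "\<And>j. weak_conv (nu_tail R B (nj j)) (\<nu> j)" and pos: "equi_positive (range \<nu>)"
    using sub by blast
  obtain \<epsilon> \<gamma> where \<epsilon>: "\<epsilon> > 0" and \<gamma>: "\<gamma> > 0"
    and E: "\<forall>x. (\<forall>i. 0 \<le> x $ i \<and> x $ i < 1) \<longrightarrow> (\<forall>M\<in>range \<nu>. \<exists>k. int_vec k \<and> (x = 0 \<longrightarrow> k = 0) \<and>
        (\<forall>y. norm y < \<gamma> \<longrightarrow> \<epsilon> \<le> cmod (fourier M (x + y + k))))"
    using pos unfolding equi_positive_def by (elim exE conjE)
  have factor: "fourier \<mu> \<xi> = fourier (mu_n R B (nj j)) \<xi> * fourier (\<nu> j) (\<xi> v* invprod R (nj j))" for j \<xi>
    by (rule fourier_limit_factor[OF mu \<nu>])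
  have mu_n_prob: "borel_prob (mu_n R B n)" for n
    by (simp add: mu_n_def borel_prob_conv_deltas)
  define good where "good = (\<lambda>(j, \<Lambda>). tight (mu_n R B (nj j)) \<Lambda> \<and> (\<forall>l\<in>\<Lambda>. int_vec l) \<and>
     (\<forall>l\<in>\<Lambda>. \<forall>y. norm y < \<gamma> / 2 \<longrightarrow> \<epsilon> \<le> cmod (fourier (\<nu> j) (l v* invprod R (nj j) + y))))"
  note step = tight_step[OF norm0 nj \<gamma> E]
  \<comment> \<open>Dependent choice produces nested tight sets along a further subsequence of the
    equi-positive one.\<close>
  have "\<exists>s. \<forall>k. good (s k) \<and> (fst (s k) < fst (s (Suc k)) \<and> snd (s k) \<subseteq> snd (s (Suc k)))"
  proof (rule dependent_nat_choice)
    \<comment> \<open>The empty product is 1, so the singleton of 0 starts the construction at level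
      0; one step from it yields the first good pair.\<close>
    have "tight (mu_n R B 0) {0}"
      by (simp add: tight_def fourier_mu_n)
    from step[OF this, of 0] show "\<exists>x. good x"
      unfolding good_def by auto
  next
    fix s :: "nat \<times> (real^'n) set" and k :: nat
    assume "good s"
    then obtain j' \<Lambda>' where "j' > fst s \<and> snd s \<subseteq> \<Lambda>' \<and> good (j', \<Lambda>')"
      using step[of "nj (fst s)" "snd s" "fst s"] unfolding good_def by (auto simp: case_prod_beta)
    then show "\<exists>s'. good s' \<and> (fst s < fst s' \<and> snd s \<subseteq> snd s')"
      by (intro exI[of _ "(j', \<Lambda>')"]) simp
  qed
  then obtain s where s: "\<And>k. good (s k)" "\<And>k. fst (s k) < fst (s (Suc k))" "\<And>k. snd (s k) \<subseteq> snd (s (Suc k))"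
    by blast
  define J where "J k = fst (s k)" for k
  define \<Lambda> where "\<Lambda> k = snd (s k)" for k
  have J: "strict_mono J" and \<Lambda>: "incseq \<Lambda>"
    using s(2,3) by (simp_all add: J_def[abs_def] \<Lambda>_def[abs_def] strict_mono_Suc_iff incseq_Suc_iff)
  have tight: "tight (mu_n R B (nj (J k))) (\<Lambda> k)" and int: "\<And>l. l \<in> \<Lambda> k \<Longrightarrow> int_vec l"
    and lower: "\<And>l y. l \<in> \<Lambda> k \<Longrightarrow> norm y < \<gamma> / 2 \<Longrightarrow>
        \<epsilon> \<le> cmod (fourier (\<nu> (J k)) (l v* invprod R (nj (J k)) + y))" for k
    using s(1)[of k] by (auto simp: good_def J_def \<Lambda>_def case_prod_beta)
  have fin: "finite (\<Lambda> k)" for k using tight[of k] by (simp add: tight_def)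
  have nJ: "filterlim (\<lambda>k. nj (J k)) sequentially sequentially"
    using strict_mono_compose[OF nj J] filterlim_subseq by (auto simp: o_def)
  have "is_spectrum \<mu> (\<Union>k. \<Lambda> k)"
  proof (rule is_spectrum_if_parseval[OF mu(1)])
    show "countable (\<Union>k. \<Lambda> k)" using fin by (auto intro: countable_finite)
    show "fourier \<mu> (l - l') = 0" if l: "l \<in> (\<Union>k. \<Lambda> k)" "l' \<in> (\<Union>k. \<Lambda> k)" "l \<noteq> l'" for l l'
    proof -
      obtain k k' where "l \<in> \<Lambda> k" "l' \<in> \<Lambda> k'" using l by blast
      then have "l \<in> \<Lambda> (max k k')" "l' \<in> \<Lambda> (max k k')"
        using \<Lambda> by (meson incseqD max.cobounded1 max.cobounded2 subsetD)+
      \<comment> \<open>Both points lie in one tight set, and a zero of the discrete transform is a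
        zero of \<open>fourier \<mu>\<close> by the factorisation.\<close>
      from tight_orthogonal[OF mu_n_prob tight this l(3)] show ?thesis
        by (simp add: factor[of _ "J (max k k')"])
    qed
    fix \<xi> :: "real^'n" and \<delta> :: real assume "\<delta> > 0"
    have "\<exists>k. 1 - \<delta> \<le> (\<Sum>l\<in>\<Lambda> k. (cmod (fourier \<mu> (\<xi> + l)))\<^sup>2)"
    proof (rule limit_mass_one[OF fin \<Lambda>, where e = "\<epsilon>\<^sup>2" and
          d = "\<lambda>k l. (cmod (fourier (mu_n R B (nj (J k))) (\<xi> + l)))\<^sup>2"])
      show "(\<Sum>l\<in>\<Lambda> k. (cmod (fourier (mu_n R B (nj (J k))) (\<xi> + l)))\<^sup>2) = 1" for k
        using tight[of k] by (simp add: tight_def)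
      show "(cmod (fourier \<mu> (\<xi> + l)))\<^sup>2 \<le> (cmod (fourier (mu_n R B (nj (J k))) (\<xi> + l)))\<^sup>2" for k l
        using norm_fourier_le_1[OF \<nu>(1)]
        by (intro power_mono) (auto simp: factor[of _ "J k"] norm_mult intro: mult_left_le)
      \<comment> \<open>Once the rescaled \<open>\<xi>\<close> is within
        \<open>\<gamma> / 2\<close>, it serves as the perturbation \<open>y\<close> in
        \<open>lower\<close>, uniformly over all \<open>l\<close> in \<open>\<Lambda> k\<close>.
        Squaring the resulting bound gives the constant \<open>\<epsilon>\<^sup>2\<close>.\<close>
      have "eventually (\<lambda>k. norm (\<xi> v* invprod R (nj (J k))) < \<gamma> / 2) sequentially"
        using eventually_norm_invprod_less[OF norm0, of "\<gamma> / 2" \<xi>] \<gamma> nJ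
        by (auto intro: eventually_compose_filterlim)
      then show "eventually (\<lambda>k. \<forall>l\<in>\<Lambda> k. \<epsilon>\<^sup>2 * (cmod (fourier (mu_n R B (nj (J k))) (\<xi> + l)))\<^sup>2
          \<le> (cmod (fourier \<mu> (\<xi> + l)))\<^sup>2) sequentially"
      proof eventually_elim
        case (elim k)
        show ?case
        proof
          fix l assume "l \<in> \<Lambda> k"
          have "\<epsilon> \<le> cmod (fourier (\<nu> (J k)) ((\<xi> + l) v* invprod R (nj (J k))))"
            using lower[OF \<open>l \<in> \<Lambda> k\<close> elim] by (simp add: vector_matrix_left_distrib add.commute)
          then have "\<epsilon> * cmod (fourier (mu_n R B (nj (J k))) (\<xi> + l)) \<le> cmod (fourier \<mu> (\<xi> + l))"
            by (simp add: factor[of _ "J k"] norm_mult mult.commute[of \<epsilon>] mult_left_mono)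
          then show "\<epsilon>\<^sup>2 * (cmod (fourier (mu_n R B (nj (J k))) (\<xi> + l)))\<^sup>2 \<le> (cmod (fourier \<mu> (\<xi> + l)))\<^sup>2"
            unfolding power_mult_distrib[symmetric] using \<epsilon> by (intro power_mono) auto
        qed
      qed
      have "(\<lambda>n. fourier (mu_n R B n) \<eta>) \<longlonglongrightarrow> fourier \<mu> \<eta>" for \<eta>
        by (rule weak_conv_fourier[OF mu(2) mu_n_prob mu(1)])
      then show "(\<lambda>k. (cmod (fourier (mu_n R B (nj (J k))) (\<xi> + l)))\<^sup>2) \<longlonglongrightarrow> (cmod (fourier \<mu> (\<xi> + l)))\<^sup>2" for l
        by (intro tendsto_intros filterlim_compose[OF _ nJ])
    qed (use \<epsilon> \<open>\<delta> > 0\<close> in auto)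
    then show "\<exists>F. finite F \<and> F \<subseteq> (\<Union>k. \<Lambda> k) \<and> 1 - \<delta> \<le> (\<Sum>l\<in>F. (cmod (fourier \<mu> (\<xi> + l)))\<^sup>2)"
      using fin by (metis UNIV_I UN_upper)
  qed
  moreover have "\<forall>l\<in>(\<Union>k. \<Lambda> k). int_vec l" using int by blast
  ultimately show ?thesis
    unfolding spectral_measure_def using mu(1) by blast
qed

end
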